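(* Let $T$ be a set of transpositions in the symmetric group $S_n$. Then: (a) If $G_T$ is a connected graph with a cut vertex $v$, then $\mathrm{Cay}(S_n,T)$ is integral if and only if $v$ is a complete vertex of $G_T$ and $\mathrm{Cay}(S_n,T')$ is integral, where $T'$ is the set of transpositions in $S_n$ such that $G_{T'}=(G_T-v)+v$, i.e. $G_{T'}$ is obtained from $G_T$ by deleting the vertex $v$ (with all its incident edges) and then adding $v$ back as an isolated vertex. (b) If $G_T$ is a tree, then $\mathrm{Cay}(S_n,T)$ is integral if and only if $G_T$ is (isomorphic to) the star graph $K_{1,n-1}$.
   Context: $S_n$ is the symmetric group on $[n]=\{1,\dots,n\}$. For a group $G$ and an inverse-closed subset $S\subseteq G$ not containing the identity, $\mathrm{Cay}(G,S)$ is the graph with vertex set $G$ in which $g_1,g_2$ are adjacent if and only if $g_1g_2^{-1}\in S$. For a set $T$ of transpositions in $S_n$, $G_T$ is the graph with vertex set $[n]$ in which $i,j$ are adjacent if and only if $(i,j)\in T$. A finite simple graph is integral if all eigenvalues of its adjacency matrix are integers. A vertex $v$ of a graph $\Gamma$ is a complete vertex if it is adjacent to every vertex $u\neq v$ of $\Gamma$. A cut vertex of $\Gamma$ is a vertex $v$ such that $\Gamma-v$ has more connected components than $\Gamma$. *)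

theory Defs
  imports
    "HOL-Algebra.Sym_Groups"
    "Jordan_Normal_Form.Char_Poly"
    "Graph_Theory.Graph_Theory"
begin

text \<open>
  As in \<^theory>\<open>Graph_Theory.Digraph\<close>, a finite simple graph is a symmetric,
  loop-free, finite digraph without parallel arcs (locale \<^locale>\<open>graph\<close>).
  Each edge is represented by a pair of opposite arcs, and the connected
  components of such a graph are its strongly connected components.
\<close>

definition adjacency_matrix :: "('a, 'b) pre_digraph \<Rightarrow> 'a list \<Rightarrow> complex mat" where
  "adjacency_matrix G vs =
     mat (length vs) (length vs) (\<lambda>(i, j). if vs ! i \<rightarrow>\<^bsub>G\<^esub> vs ! j then 1 else 0)"

text \<open>
  The list \<open>vs\<close> only fixes an order of the vertices; the eigenvalues do not depend on it.
\<close>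

definition integral_graph :: "('a, 'b) pre_digraph \<Rightarrow> bool" where
  "integral_graph G \<longleftrightarrow> graph G \<and>
     (\<forall>vs. distinct vs \<and> set vs = verts G \<longrightarrow>
        (\<forall>k. eigenvalue (adjacency_matrix G vs) k \<longrightarrow> k \<in> \<int>))"

definition cayley_graph :: "('g, 'm) monoid_scheme \<Rightarrow> 'g set \<Rightarrow> ('g, 'g \<times> 'g) pre_digraph" where
  "cayley_graph G S = with_proj
     \<lparr> pverts = carrier G,
       parcs = {(g, h). g \<in> carrier G \<and> h \<in> carrier G \<and> g \<otimes>\<^bsub>G\<^esub> inv\<^bsub>G\<^esub> h \<in> S} \<rparr>"

definition transpositions :: "nat \<Rightarrow> (nat \<Rightarrow> nat) set" where
  "transpositions n =
     {Transposition.transpose i j | i j. i \<in> {1..n} \<and> j \<in> {1..n} \<and> i \<noteq> j}"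

definition transposition_graph :: "nat \<Rightarrow> (nat \<Rightarrow> nat) set \<Rightarrow> (nat, nat \<times> nat) pre_digraph" where
  "transposition_graph n T = with_proj
     \<lparr> pverts = {1..n},
       parcs = {(i, j). i \<in> {1..n} \<and> j \<in> {1..n} \<and> i \<noteq> j \<and> Transposition.transpose i j \<in> T} \<rparr>"

definition complete_vertex :: "('a, 'b) pre_digraph \<Rightarrow> 'a \<Rightarrow> bool" where
  "complete_vertex G v \<longleftrightarrow> v \<in> verts G \<and> (\<forall>u \<in> verts G. u \<noteq> v \<longrightarrow> v \<rightarrow>\<^bsub>G\<^esub> u)"

definition cut_vertex :: "('a, 'b) pre_digraph \<Rightarrow> 'a \<Rightarrow> bool" where
  "cut_vertex G v \<longleftrightarrow> v \<in> verts G \<and>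
     card (pre_digraph.sccs (pre_digraph.del_vert G v)) > card (pre_digraph.sccs G)"

text \<open>
  \<^const>\<open>Digraph_Component.tree\<close> is not suitable for symmetric digraphs:
  \<^const>\<open>pre_digraph.cycle\<close> admits cycles of length 2, i.e. walking back and forth along
  an edge. A cycle of a simple graph has length at least 3.
\<close>

definition tree_graph :: "('a, 'b) pre_digraph \<Rightarrow> bool" where
  "tree_graph G \<longleftrightarrow> graph G \<and> Digraph_Component.connected G \<and>
     \<not> (\<exists>p. pre_digraph.cycle G p \<and> length p \<ge> 3)"

lemma graph_with_projI:
  assumes "finite V" "E \<subseteq> V \<times> V" "sym E" "\<And>x. (x, x) \<notin> E"
  shows "graph (with_proj \<lparr> pverts = V, parcs = E \<rparr>)"
proof -
  have "finite E"
    using assms(1,2) by (meson finite_SigmaI finite_subset)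
  then interpret pair_graph "\<lparr> pverts = V, parcs = E \<rparr>"
    using assms by unfold_locales (auto simp: symmetric_def)
  show ?thesis by unfold_locales
qed

lemma graph_transposition_graph: "graph (transposition_graph n T)"
  unfolding transposition_graph_def
  by (rule graph_with_projI) (auto intro!: symI simp: transpose_commute)

lemma graph_cayley_graph:
  assumes "group G" "finite (carrier G)" "S \<subseteq> carrier G"
    and "\<And>s. s \<in> S \<Longrightarrow> inv\<^bsub>G\<^esub> s \<in> S" and "\<one>\<^bsub>G\<^esub> \<notin> S"
  shows "graph (cayley_graph G S)"
proof -
  interpret group G by fact
  let ?E = "{(g, h). g \<in> carrier G \<and> h \<in> carrier G \<and> g \<otimes>\<^bsub>G\<^esub> inv\<^bsub>G\<^esub> h \<in> S}"
  have "(h, g) \<in> ?E" if "(g, h) \<in> ?E" for g h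
  proof -
    have gh: "g \<in> carrier G" "h \<in> carrier G" "g \<otimes>\<^bsub>G\<^esub> inv\<^bsub>G\<^esub> h \<in> S"
      using that by simp_all
    have "inv\<^bsub>G\<^esub> (g \<otimes>\<^bsub>G\<^esub> inv\<^bsub>G\<^esub> h) = h \<otimes>\<^bsub>G\<^esub> inv\<^bsub>G\<^esub> g"
      using gh(1,2) by (simp add: inv_mult_group)
    then show ?thesis using assms(4)[OF gh(3)] gh by simp
  qed
  then have "sym ?E" by (intro symI)
  moreover have "(g, g) \<notin> ?E" for g
  proof
    assume "(g, g) \<in> ?E"
    then have g: "g \<in> carrier G" "g \<otimes>\<^bsub>G\<^esub> inv\<^bsub>G\<^esub> g \<in> S" by blast+
    have "\<one>\<^bsub>G\<^esub> \<in> S" using g(2) unfolding r_inv[OF g(1)] .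
    with assms(5) show False by contradiction
  qed
  moreover have "?E \<subseteq> carrier G \<times> carrier G" by (rule subsetI) (simp add: split_beta mem_Times_iff)
  ultimately show ?thesis
    unfolding cayley_graph_def by (intro graph_with_projI[OF assms(2)])
qed

lemma graph_cayley_graph_transpositions:
  assumes "T \<subseteq> transpositions n"
  shows "graph (cayley_graph (sym_group n) T)"
proof (rule graph_cayley_graph)
  show "group (sym_group n)" by (rule sym_group_is_group)
  show "finite (carrier (sym_group n))" by (simp add: sym_group_def finite_permutations)
  show sub: "T \<subseteq> carrier (sym_group n)"
  proof
    fix t assume "t \<in> T"
    then obtain i j where "t = Transposition.transpose i j" "i \<in> {1..n}" "j \<in> {1..n}"
      using assms unfolding transpositions_def by blast
    then show "t \<in> carrier (sym_group n)"
      by (simp only: sym_group_carrier permutes_swap_id)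
  qed
  show "inv\<^bsub>sym_group n\<^esub> s \<in> T" if s: "s \<in> T" for s
  proof -
    obtain i j where "s = Transposition.transpose i j"
      using assms s unfolding transpositions_def by blast
    then have "inv' s = s" by simp
    moreover have "s \<in> carrier (sym_group n)" using sub s by blast
    ultimately show ?thesis using s by simp
  qed
  show "\<one>\<^bsub>sym_group n\<^esub> \<notin> T"
  proof
    assume "\<one>\<^bsub>sym_group n\<^esub> \<in> T"
    with assms have "id \<in> transpositions n" by (metis subsetD sym_group_one)
    then obtain i j :: nat where ij: "i \<noteq> j" "id = Transposition.transpose i j"
      unfolding transpositions_def by blast
    from ij(2) have "id i = Transposition.transpose i j i" by (rule fun_cong)
    with \<open>i \<noteq> j\<close> show False by simp
  qed
qed

lemma ex1_transpositions_isolate_vertex: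
  assumes "T \<subseteq> transpositions n" "v \<in> {1..n}"
  shows "\<exists>!T'. T' \<subseteq> transpositions n \<and> transposition_graph n T' =
           pre_digraph.add_vert (pre_digraph.del_vert (transposition_graph n T) v) v"
proof -
  have mem: "t \<in> A \<longleftrightarrow> (\<exists>a \<in> arcs (transposition_graph n A). t = Transposition.transpose (fst a) (snd a))"
    if "A \<subseteq> transpositions n" for A t
  proof
    assume "t \<in> A"
    moreover from this that obtain i j where
      "t = Transposition.transpose i j" "i \<in> {1..n}" "j \<in> {1..n}" "i \<noteq> j"
      unfolding transpositions_def by blast
    ultimately show "\<exists>a \<in> arcs (transposition_graph n A). t = Transposition.transpose (fst a) (snd a)"
      by (intro bexI[of _ "(i, j)"]) (simp_all add: transposition_graph_def)
  qed (auto simp: transposition_graph_def)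
  show ?thesis
  proof (rule ex_ex1I)
    let ?T = "{t \<in> T. t v = v}"
    have "Transposition.transpose i j v = v \<longleftrightarrow> i \<noteq> v \<and> j \<noteq> v" if "i \<noteq> j" for i j :: nat
      using that by (auto simp: Transposition.transpose_def)
    then have "transposition_graph n ?T =
        pre_digraph.add_vert (pre_digraph.del_vert (transposition_graph n T) v) v"
      using assms(2)
      by (auto simp: transposition_graph_def with_proj_def pre_digraph.add_vert_def
          pre_digraph.del_vert_def)
    then show "\<exists>T'. T' \<subseteq> transpositions n \<and> transposition_graph n T' =
        pre_digraph.add_vert (pre_digraph.del_vert (transposition_graph n T) v) v"
      using assms(1) by (intro exI[of _ ?T]) auto
  next
    fix A B
    assume "A \<subseteq> transpositions n \<and> transposition_graph n A =
        pre_digraph.add_vert (pre_digraph.del_vert (transposition_graph n T) v) v"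
      and "B \<subseteq> transpositions n \<and> transposition_graph n B =
        pre_digraph.add_vert (pre_digraph.del_vert (transposition_graph n T) v) v"
    then have "t \<in> A \<longleftrightarrow> t \<in> B" for t
      using mem[of A t] mem[of B t] by simp
    then show "A = B" by blast
  qed
qed

end

theory Submission
  imports Defs
begin

text \<open>
  Functions on \<open>S\<^sub>n\<close> carry the operator \<open>A\<^sub>T f (g) = \<Sum>t\<in>T. f (t g)\<close>, which is the adjacency
  operator of \<open>Cay(S\<^sub>n, T)\<close>. If \<open>v\<close> is a complete vertex, then \<open>A\<^sub>T = A\<^sub>T\<^sub>' + J\<close>, where \<open>J\<close> is the
  Jucys-Murphy element of all transpositions moving \<open>v\<close>. It commutes with \<open>A\<^sub>T\<^sub>'\<close>, because the
  elements of \<open>T'\<close> fix \<open>v\<close>, and has integer eigenvalues; so integrality for \<open>T\<close> and for \<open>T'\<close>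
  are equivalent.

  Conversely, the functions \<open>g \<mapsto> x (g 1)\<close> embed the natural permutation representation, on which
  \<open>A\<^sub>T\<close> acts as \<open>card T - L\<close> with \<open>L\<close> the Laplacian of \<open>G\<^sub>T\<close>. Hence integrality forces the
  algebraic connectivity of \<open>G\<^sub>T\<close> to be at least 1. If \<open>v\<close> separates \<open>C\<close> from \<open>D\<close>, the function that is
  \<open>card D\<close> on \<open>C\<close>, \<open>- card C\<close> on \<open>D\<close> and 0 at \<open>v\<close> has Rayleigh quotient less than 1 unless \<open>v\<close> is
  adjacent to all other vertices.
\<close>

section \<open>Spectral decomposition of symmetric operators\<close>

text \<open>Gaussian elimination: an unknown \<open>j\<close> occurring in the new equation
  \<open>x\<close> is eliminated from the others, which leaves one equation and one unknown fewer.
  Used to find a linear relation between the powers of an operator applied to a vector.\<close>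

lemma homogeneous_system_nontrivial:
  fixes f :: "'i \<Rightarrow> 'a \<Rightarrow> 'k::field"
  assumes "finite V" "finite I" "card V < card I"
  shows "\<exists>c. (\<exists>i\<in>I. c i \<noteq> 0) \<and> (\<forall>z\<in>V. (\<Sum>i\<in>I. c i * f i z) = 0)"
  using assms
proof (induction V arbitrary: I f rule: finite_induct)
  case empty
  then obtain i where "i \<in> I" by fastforce
  then show ?case by (intro exI[of _ "\<lambda>_. 1"]) auto
next
  case (insert x V)
  show ?case
  proof (cases "\<forall>i\<in>I. f i x = 0")
    case True
    from insert.IH[of I f] insert.prems insert.hyps obtain c where
      "\<exists>i\<in>I. c i \<noteq> 0" "\<forall>z\<in>V. (\<Sum>i\<in>I. c i * f i z) = 0" by auto
    with True show ?thesis by (intro exI[of _ c]) auto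
  next
    case False
    then obtain j where j: "j \<in> I" "f j x \<noteq> 0" by blast
    have "card V < card (I - {j})" using insert.prems insert.hyps j by simp
    from insert.IH[OF _ this, of "\<lambda>i z. f i z - f i x / f j x * f j z"] insert.prems
    obtain c where c: "\<exists>i\<in>I-{j}. c i \<noteq> 0"
      "\<forall>z\<in>V. (\<Sum>i\<in>I-{j}. c i * (f i z - f i x / f j x * f j z)) = 0" by auto
    \<comment> \<open>Back-substitution: \<open>d j\<close> is solved from equation
      \<open>x\<close>. In the reduced system all coefficients at \<open>x\<close> vanish, so
      \<open>eq\<close> yields equation \<open>x\<close> as well.\<close>
    define d where "d = (\<lambda>i. if i = j then - (\<Sum>i\<in>I-{j}. c i * (f i x / f j x)) else c i)"
    have eq: "(\<Sum>i\<in>I. d i * f i z) = (\<Sum>i\<in>I-{j}. c i * (f i z - f i x / f j x * f j z))" for z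
    proof -
      have "(\<Sum>i\<in>I. d i * f i z) = d j * f j z + (\<Sum>i\<in>I-{j}. d i * f i z)"
        using insert.prems j by (simp add: sum.remove)
      also have "(\<Sum>i\<in>I-{j}. d i * f i z) = (\<Sum>i\<in>I-{j}. c i * f i z)"
        by (intro sum.cong) (auto simp: d_def)
      also have "d j * f j z = - (\<Sum>i\<in>I-{j}. c i * (f i x / f j x) * f j z)"
        by (simp add: d_def sum_distrib_right)
      finally show ?thesis
        by (simp add: right_diff_distrib sum_subtractf mult.assoc)
    qed
    have "\<forall>z\<in>insert x V. (\<Sum>i\<in>I. d i * f i z) = 0"
      using c(2) j by (auto simp: eq)
    moreover have "\<exists>i\<in>I. d i \<noteq> 0" using c(1) by (auto simp: d_def)
    ultimately show ?thesis by blast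
  qed
qed

text \<open>A self-adjoint operator for the standard Hermitian form on \<open>V\<close>. The space
  \<open>W\<close> is a parameter, so that the results apply again to an operator restricted to an
  eigenspace of another one.\<close>

locale symmetric_operator =
  fixes V :: "'a set" and W :: "('a \<Rightarrow> complex) set" and A :: "('a \<Rightarrow> complex) \<Rightarrow> 'a \<Rightarrow> complex"
  assumes finite_V: "finite V"
    and support: "f \<in> W \<Longrightarrow> z \<notin> V \<Longrightarrow> f z = 0"
    and combination: "f \<in> W \<Longrightarrow> g \<in> W \<Longrightarrow> (\<lambda>z. a * f z + g z) \<in> W"
    and invariant: "f \<in> W \<Longrightarrow> A f \<in> W"
    and linear: "A (\<lambda>z. a * f z + g z) = (\<lambda>z. a * A f z + A g z)"
    and symmetric: "f \<in> W \<Longrightarrow> g \<in> W \<Longrightarrow>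
      (\<Sum>z\<in>V. A f z * cnj (g z)) = (\<Sum>z\<in>V. f z * cnj (A g z))"
begin

text \<open>The summands are indexed by their eigenvalues, so distinct summands belong to distinct
  eigenvalues and are orthogonal; a summand may be zero.\<close>

definition eigensum :: "('a \<Rightarrow> complex) \<Rightarrow> bool" where
  "eigensum x \<longleftrightarrow> (\<exists>R g. finite R \<and> (\<forall>r\<in>R. g r \<in> W \<and> A (g r) = (\<lambda>z. r * g r z)) \<and>
     x = (\<lambda>z. \<Sum>r\<in>R. g r z))"

text \<open>The vector \<open>p(A) x\<close>, evaluated by Horner's scheme.\<close>

definition poly_apply :: "complex poly \<Rightarrow> ('a \<Rightarrow> complex) \<Rightarrow> 'a \<Rightarrow> complex" where
  "poly_apply p x = fold_coeffs (\<lambda>a h z. a * x z + A h z) p (\<lambda>_. 0)"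

section \<open>Linearity, and polynomials in the operator\<close>

lemma map_zero: "A (\<lambda>_. 0) = (\<lambda>_. 0)"
  using linear[of "-1" "\<lambda>_. 0" "\<lambda>_. 0"] by (simp add: fun_eq_iff)

lemma map_add: "A (\<lambda>z. f z + g z) = (\<lambda>z. A f z + A g z)"
  using linear[of 1 f g] by simp

lemma map_scale: "A (\<lambda>z. a * f z) = (\<lambda>z. a * A f z)"
  using linear[of a f "\<lambda>_. 0"] by (simp add: map_zero)

lemma map_sum: "A (\<lambda>z. \<Sum>i\<in>I. f i z) = (\<lambda>z. \<Sum>i\<in>I. A (f i) z)"
  by (induction I rule: infinite_finite_induct) (simp_all add: map_zero map_add)

lemma zero_mem: "f \<in> W \<Longrightarrow> (\<lambda>_. 0) \<in> W"
  using combination[of f f "-1"] by simp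

lemma scale_mem: "f \<in> W \<Longrightarrow> (\<lambda>z. a * f z) \<in> W"
  using combination[of f "\<lambda>_. 0" a] zero_mem by simp

lemma sum_mem:
  "finite I \<Longrightarrow> h \<in> W \<Longrightarrow> (\<And>i. i \<in> I \<Longrightarrow> f i \<in> W) \<Longrightarrow> (\<lambda>z. \<Sum>i\<in>I. f i z) \<in> W"
proof (induction I rule: finite_induct)
  case empty
  then show ?case by (simp add: zero_mem)
next
  case (insert i I)
  then show ?case using combination[of "f i" _ 1] by simp
qed

lemma poly_apply_0 [simp]: "poly_apply 0 x = (\<lambda>_. 0)"
  by (simp add: poly_apply_def)

lemma poly_apply_pCons [simp]: "poly_apply (pCons a p) x = (\<lambda>z. a * x z + A (poly_apply p x) z)"
  by (cases "a = 0 \<and> p = 0") (auto simp: poly_apply_def map_zero)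

lemma poly_apply_add: "poly_apply (p + q) x = (\<lambda>z. poly_apply p x z + poly_apply q x z)"
  by (induction p q rule: poly_induct2) (simp_all add: map_add algebra_simps)

lemma poly_apply_monom: "poly_apply (monom c i) x = (\<lambda>z. c * (A ^^ i) x z)"
  by (induction i) (simp_all add: monom_0 monom_Suc map_scale map_zero)

lemma poly_apply_sum: "poly_apply (\<Sum>i\<in>I. p i) x = (\<lambda>z. \<Sum>i\<in>I. poly_apply (p i) x z)"
  by (induction I rule: infinite_finite_induct) (simp_all add: poly_apply_add)

text \<open>A linear factor may be applied to \<open>x\<close> first; this form lets an induction on
  the degree pass from \<open>x\<close> to \<open>(A - r) x\<close>.\<close>

lemma poly_apply_root_mult:
  "poly_apply ([:- r, 1:] * p) x = poly_apply p (\<lambda>z. - r * x z + A x z)"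
proof (induction p)
  case (pCons a p)
  have "[:- r, 1:] * pCons a p = [:- (r * a), a:] + pCons 0 ([:- r, 1:] * p)"
    by simp
  then have "poly_apply ([:- r, 1:] * pCons a p) x =
      (\<lambda>z. - (r * a) * x z + a * A x z + A (poly_apply ([:- r, 1:] * p) x) z)"
    by (simp only: poly_apply_add poly_apply_pCons poly_apply_0 map_zero) (simp add: map_scale)
  then show ?case
    unfolding pCons.IH by (simp add: algebra_simps)
qed simp

text \<open>The \<open>card V + 1\<close> vectors \<open>(A ^^ i) x\<close> with
  \<open>i \<le> card V\<close> are functions supported on \<open>V\<close>, hence linearly
  dependent.\<close>

lemma annihilating_poly:
  assumes "x \<in> W"
  shows "\<exists>p. p \<noteq> 0 \<and> poly_apply p x = (\<lambda>_. 0)"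
proof -
  obtain c where c: "\<exists>i\<in>{..card V}. c i \<noteq> 0"
    "\<forall>z\<in>V. (\<Sum>i\<in>{..card V}. c i * (A ^^ i) x z) = 0"
    using homogeneous_system_nontrivial[OF finite_V, of "{..card V}" "\<lambda>i. (A ^^ i) x"] by auto
  define p where "p = (\<Sum>i\<le>card V. monom (c i) i)"
  have mem: "(A ^^ i) x \<in> W" for i
    by (induction i) (simp_all add: assms invariant)
  have "poly_apply p x z = 0" for z
    using c(2) support[OF mem] by (cases "z \<in> V") (simp_all add: p_def poly_apply_sum poly_apply_monom)
  moreover have "p \<noteq> 0"
  proof -
    obtain i where i: "i \<le> card V" "c i \<noteq> 0" using c(1) by auto
    have "coeff p i = c i" using i by (simp add: p_def coeff_sum if_distrib cong: if_cong)
    with i show ?thesis by auto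
  qed
  ultimately show ?thesis by blast
qed

section \<open>Self-adjointness: real eigenvalues, diagonalisation, Rayleigh quotients\<close>

lemma norm_sum_eq_0:
  assumes "f \<in> W" "(\<Sum>z\<in>V. f z * cnj (f z)) = 0"
  shows "f = (\<lambda>_. 0)"
proof
  fix z
  have "(\<Sum>z\<in>V. f z * cnj (f z)) = of_real (\<Sum>z\<in>V. (cmod (f z))\<^sup>2)"
    by (simp only: of_real_sum complex_norm_square)
  with assms(2) have "(\<Sum>z\<in>V. (cmod (f z))\<^sup>2) = 0" by (metis of_real_eq_0_iff)
  then have "\<forall>z\<in>V. f z = 0" by (simp add: sum_nonneg_eq_0_iff finite_V)
  then show "f z = 0" using support[OF assms(1)] by blast
qed

lemma eigenvalue_real:
  assumes "w \<in> W" "A w = (\<lambda>z. r * w z)" "w \<noteq> (\<lambda>_. 0)"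
  shows "cnj r = r"
proof -
  have "r * (\<Sum>z\<in>V. w z * cnj (w z)) = cnj r * (\<Sum>z\<in>V. w z * cnj (w z))"
    using symmetric[OF assms(1,1)] by (simp add: assms(2) sum_distrib_left mult_ac)
  then show ?thesis using norm_sum_eq_0 assms by auto
qed

text \<open>The kernel of \<open>(A - r)^2\<close> is that of \<open>A - r\<close>: moving
  \<open>A - r\<close> to the other side gives \<open><w, w> = <u, (A - r) w> = 0\<close>. The move
  needs \<open>r\<close> real, which holds because a nonzero \<open>w\<close> would be an
  eigenvector.\<close>

lemma eigenspace_semisimple:
  assumes "u \<in> W" and w: "w = (\<lambda>z. - r * u z + A u z)" and Aw: "A w = (\<lambda>z. r * w z)"
  shows "w = (\<lambda>_. 0)"
proof (rule ccontr)
  assume nz: "w \<noteq> (\<lambda>_. 0)"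
  have wW: "w \<in> W" unfolding w by (intro combination invariant assms)
  have r: "cnj r = r" by (rule eigenvalue_real[OF wW Aw nz])
  have "(\<Sum>z\<in>V. w z * cnj (w z)) = (\<Sum>z\<in>V. - r * (u z * cnj (w z)) + A u z * cnj (w z))"
    by (rule sum.cong) (simp_all add: w algebra_simps)
  also have "\<dots> = - r * (\<Sum>z\<in>V. u z * cnj (w z)) + (\<Sum>z\<in>V. u z * cnj (A w z))"
    by (simp only: sum.distrib sum_distrib_left symmetric[OF assms(1) wW])
  also have "\<dots> = 0"
    by (simp add: Aw r sum_distrib_left mult_ac sum_negf)
  finally show False using norm_sum_eq_0[OF wW] nz by blast
qed

text \<open>
  Peel off one root \<open>r\<close> of \<open>p\<close>: decompose \<open>(A - r) x\<close> and divide its components for \<open>s \<noteq> r\<close> by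
  \<open>s - r\<close>. What remains of \<open>x\<close> is killed by \<open>(A - r)\<^sup>2\<close>, hence by \<open>A - r\<close>.
\<close>

lemma eigensum_if_poly_apply_eq_0:
  "p \<noteq> 0 \<Longrightarrow> x \<in> W \<Longrightarrow> poly_apply p x = (\<lambda>_. 0) \<Longrightarrow> eigensum x"
proof (induction "degree p" arbitrary: p x)
  case 0
  then obtain c where "p = [:c:]" "c \<noteq> 0" by (metis degree_eq_zeroE pCons_0_0)
  with 0 have "x = (\<lambda>_. 0)" by (auto simp: map_zero fun_eq_iff)
  then show ?case unfolding eigensum_def by (intro exI[of _ "{}"]) simp
next
  case (Suc d)
  have "\<not> constant (poly p)" using Suc.hyps(2) by (simp add: constant_degree)
  then obtain r where "poly p r = 0" using fundamental_theorem_of_algebra by blast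
  then obtain q where pq: "p = [:- r, 1:] * q" using poly_eq_0_iff_dvd by (metis dvdE)
  have "q \<noteq> 0" using Suc.prems(1) pq by auto
  then have "degree p = 1 + degree q" unfolding pq by (subst degree_mult_eq) auto
  with Suc.hyps(2) \<open>q \<noteq> 0\<close> have q: "q \<noteq> 0" "degree q = d" by simp_all
  define y where "y = (\<lambda>z. - r * x z + A x z)"
  have "y \<in> W" unfolding y_def by (intro combination invariant Suc.prems)
  moreover have "poly_apply q y = (\<lambda>_. 0)"
    using Suc.prems(3) unfolding pq poly_apply_root_mult y_def .
  ultimately obtain R g where R: "finite R" and g: "\<And>s. s \<in> R \<Longrightarrow> g s \<in> W"
    "\<And>s. s \<in> R \<Longrightarrow> A (g s) = (\<lambda>z. s * g s z)" and y: "y = (\<lambda>z. \<Sum>s\<in>R. g s z)"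
    using Suc.hyps(1)[of q y] q unfolding eigensum_def by blast
  \<comment> \<open>For \<open>s = r\<close> the division by zero makes \<open>h s\<close> the zero
    function, so the next facts hold on all of \<open>R\<close>.\<close>
  define h where "h = (\<lambda>s z. 1 / (s - r) * g s z)"
  have h: "h s \<in> W" "A (h s) = (\<lambda>z. s * h s z)" if "s \<in> R" for s
    using g[OF that] by (simp_all only: h_def scale_mem map_scale) (simp add: fun_eq_iff)
  define x' where "x' = (\<lambda>z. \<Sum>s\<in>R-{r}. h s z)"
  have x': "x' \<in> W"
    unfolding x'_def using R h Suc.prems by (intro sum_mem[where h = x]) auto
  define u where "u = (\<lambda>z. - 1 * x' z + x z)"
  have u: "u \<in> W" unfolding u_def by (intro combination x' Suc.prems)
  define w where "w = (\<lambda>z. - r * u z + A u z)"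
  have Ax': "A x' = (\<lambda>z. \<Sum>s\<in>R-{r}. s * h s z)"
    unfolding x'_def map_sum by (intro ext sum.cong) (auto simp: h)
  \<comment> \<open>Since \<open>(s - r) * h s = g s\<close>, passing from \<open>x\<close> to
    \<open>u\<close> removes from \<open>y\<close> every component except the one for
    \<open>r\<close>.\<close>
  have w_eq: "w = (\<lambda>z. if r \<in> R then g r z else 0)"
  proof
    fix z
    have "w z = y z - (A x' z - r * x' z)"
      unfolding w_def u_def linear y_def by (simp add: algebra_simps)
    also have "A x' z - r * x' z = (\<Sum>s\<in>R-{r}. (s - r) * h s z)"
      unfolding Ax' unfolding x'_def by (simp add: sum_distrib_left sum_subtractf left_diff_distrib)
    also have "\<dots> = (\<Sum>s\<in>R-{r}. g s z)"
      by (intro sum.cong) (auto simp: h_def)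
    also have "y z = (if r \<in> R then g r z else 0) + (\<Sum>s\<in>R-{r}. g s z)"
      unfolding y using R by (simp add: sum.remove)
    finally show "w z = (if r \<in> R then g r z else 0)" by simp
  qed
  have "A w = (\<lambda>z. r * w z)"
    unfolding w_eq using g(2) by (cases "r \<in> R") (simp_all add: map_zero)
  with u w_def have "w = (\<lambda>_. 0)" by (rule eigenspace_semisimple)
  then have Au: "A u = (\<lambda>z. r * u z)" by (simp add: w_def fun_eq_iff)
  define k where "k = (\<lambda>s. if s = r then u else h s)"
  have "\<forall>s\<in>insert r R. k s \<in> W \<and> A (k s) = (\<lambda>z. s * k s z)"
    using u Au h by (auto simp: k_def)
  moreover have "x = (\<lambda>z. \<Sum>s\<in>insert r R. k s z)"
  proof
    fix z
    have "(\<Sum>s\<in>insert r R. k s z) = k r z + (\<Sum>s\<in>R-{r}. k s z)"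
      using R by (simp add: sum.insert_remove)
    also have "(\<Sum>s\<in>R-{r}. k s z) = x' z"
      unfolding x'_def by (intro sum.cong) (auto simp: k_def)
    finally show "x z = (\<Sum>s\<in>insert r R. k s z)" by (simp add: k_def u_def)
  qed
  ultimately show ?case unfolding eigensum_def using R by (intro exI[of _ "insert r R"] exI[of _ k]) simp
qed

lemma eigensum: "x \<in> W \<Longrightarrow> eigensum x"
  using annihilating_poly eigensum_if_poly_apply_eq_0 by blast

lemma eigenvector_exists:
  assumes "x \<in> W" "x \<noteq> (\<lambda>_. 0)"
  obtains r f where "f \<in> W" "f \<noteq> (\<lambda>_. 0)" "A f = (\<lambda>z. r * f z)"
proof -
  obtain R g where g: "\<And>r. r \<in> R \<Longrightarrow> g r \<in> W" "\<And>r. r \<in> R \<Longrightarrow> A (g r) = (\<lambda>z. r * g r z)"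
    and x: "x = (\<lambda>z. \<Sum>r\<in>R. g r z)"
    using eigensum[OF assms(1)] unfolding eigensum_def by blast
  have "\<exists>r\<in>R. g r \<noteq> (\<lambda>_. 0)"
  proof (rule ccontr)
    assume "\<not> ?thesis"
    then have "x = (\<lambda>_. 0)" unfolding x by (intro ext sum.neutral) auto
    with assms show False by blast
  qed
  with g that show thesis by blast
qed

lemma eigenvectors_orthogonal:
  assumes "f \<in> W" "A f = (\<lambda>z. r * f z)" "g \<in> W" "A g = (\<lambda>z. s * g z)" "r \<noteq> s"
  shows "(\<Sum>z\<in>V. f z * cnj (g z)) = 0"
proof (cases "g = (\<lambda>_. 0)")
  case False
  then have "cnj s = s" using eigenvalue_real assms by blast
  then have "r * (\<Sum>z\<in>V. f z * cnj (g z)) = s * (\<Sum>z\<in>V. f z * cnj (g z))"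
    using symmetric[OF assms(1,3)] by (simp add: assms(2,4) sum_distrib_left mult_ac)
  then show ?thesis using assms(5) by simp
qed simp

text \<open>
  Only eigenvectors that are not orthogonal to \<open>x\<close> occur in the spectral decomposition
  of \<open>x\<close>.
\<close>

lemma rayleigh_le:
  assumes x: "x \<in> W"
    and bound: "\<And>k g. g \<in> W \<Longrightarrow> g \<noteq> (\<lambda>_. 0) \<Longrightarrow> A g = (\<lambda>z. k * g z) \<Longrightarrow>
      (\<Sum>z\<in>V. g z * cnj (x z)) \<noteq> 0 \<Longrightarrow> Re k \<le> c"
  shows "Re (\<Sum>z\<in>V. A x z * cnj (x z)) \<le> c * (\<Sum>z\<in>V. (cmod (x z))\<^sup>2)"
proof -
  obtain R g where R: "finite R" and g: "\<And>k. k \<in> R \<Longrightarrow> g k \<in> W"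
    "\<And>k. k \<in> R \<Longrightarrow> A (g k) = (\<lambda>z. k * g k z)" and xg: "x = (\<lambda>z. \<Sum>k\<in>R. g k z)"
    using eigensum[OF x] unfolding eigensum_def by blast
  define N where "N = (\<lambda>k. \<Sum>z\<in>V. (cmod (g k z))\<^sup>2)"
  \<comment> \<open>By orthogonality of the components, pairing \<open>g k\<close> with
    \<open>x\<close> gives its own squared norm \<open>N k\<close>. Hence a component orthogonal to
    \<open>x\<close> is zero and contributes nothing.\<close>
  have N: "(\<Sum>z\<in>V. g k z * cnj (x z)) = of_real (N k)" if k: "k \<in> R" for k
  proof -
    have "(\<Sum>z\<in>V. g k z * cnj (x z)) = (\<Sum>z\<in>V. \<Sum>l\<in>R. g k z * cnj (g l z))"
      by (simp add: xg sum_distrib_left)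
    also have "\<dots> = (\<Sum>l\<in>R. \<Sum>z\<in>V. g k z * cnj (g l z))" by (rule sum.swap)
    also have "\<dots> = (\<Sum>l\<in>R. if l = k then of_real (N k) else 0)"
      using eigenvectors_orthogonal[OF g[OF k] g]
      by (intro sum.cong) (auto simp only: N_def of_real_sum complex_norm_square if_True if_False split: if_split)
    also have "\<dots> = of_real (N k)" using R k by simp
    finally show ?thesis .
  qed
  have "(\<Sum>z\<in>V. x z * cnj (x z)) = (\<Sum>z\<in>V. \<Sum>k\<in>R. g k z * cnj (x z))"
    by (subst xg) (simp add: sum_distrib_right)
  also have "\<dots> = (\<Sum>k\<in>R. \<Sum>z\<in>V. g k z * cnj (x z))" by (rule sum.swap)
  also have "\<dots> = (\<Sum>k\<in>R. of_real (N k))" using N by (intro sum.cong) auto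
  finally have "of_real (\<Sum>z\<in>V. (cmod (x z))\<^sup>2) = complex_of_real (\<Sum>k\<in>R. N k)"
    by (simp only: of_real_sum complex_norm_square)
  then have nx: "(\<Sum>z\<in>V. (cmod (x z))\<^sup>2) = (\<Sum>k\<in>R. N k)" by (simp only: of_real_eq_iff)
  have Ax: "A x = (\<lambda>z. \<Sum>k\<in>R. k * g k z)"
    by (subst xg) (simp add: map_sum g(2))
  have "(\<Sum>z\<in>V. A x z * cnj (x z)) = (\<Sum>z\<in>V. \<Sum>k\<in>R. k * (g k z * cnj (x z)))"
    unfolding Ax by (simp add: sum_distrib_right mult.assoc)
  also have "\<dots> = (\<Sum>k\<in>R. \<Sum>z\<in>V. k * (g k z * cnj (x z)))" by (rule sum.swap)
  also have "\<dots> = (\<Sum>k\<in>R. k * of_real (N k))"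
    using N by (intro sum.cong) (auto simp flip: sum_distrib_left)
  finally have "Re (\<Sum>z\<in>V. A x z * cnj (x z)) = (\<Sum>k\<in>R. Re k * N k)" by simp
  also have "\<dots> \<le> (\<Sum>k\<in>R. c * N k)"
  proof (rule sum_mono)
    fix k assume k: "k \<in> R"
    have "0 \<le> N k" unfolding N_def by (intro sum_nonneg) simp
    moreover have "Re k \<le> c" if nz: "N k \<noteq> 0"
    proof (rule bound[OF g(1)[OF k] _ g(2)[OF k]])
      show "g k \<noteq> (\<lambda>_. 0)" using nz by (auto simp: N_def)
      show "(\<Sum>z\<in>V. g k z * cnj (x z)) \<noteq> 0" using N[OF k] nz by simp
    qed
    ultimately show "Re k * N k \<le> c * N k" by (cases "N k = 0") (auto intro: mult_right_mono)
  qed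
  also have "\<dots> = c * (\<Sum>z\<in>V. (cmod (x z))\<^sup>2)" by (simp add: nx sum_distrib_left)
  finally show ?thesis .
qed

end

section \<open>The adjacency operator of the Cayley graph\<close>

definition supported :: "'a set \<Rightarrow> ('a \<Rightarrow> complex) set" where
  "supported V = {f. \<forall>z. z \<notin> V \<longrightarrow> f z = 0}"

definition integral_operator ::
  "('a \<Rightarrow> complex) set \<Rightarrow> (('a \<Rightarrow> complex) \<Rightarrow> 'a \<Rightarrow> complex) \<Rightarrow> bool" where
  "integral_operator W A \<longleftrightarrow>
     (\<forall>k f. f \<in> W \<and> f \<noteq> (\<lambda>_. 0) \<and> A f = (\<lambda>z. k * f z) \<longrightarrow> k \<in> \<int>)"

text \<open>The action is a parameter because two occur: \<open>(\<circ>)\<close>, left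
  multiplication on permutations, and \<open>\<lambda>t. t\<close>, the action on points.\<close>

definition action_sum :: "('t \<Rightarrow> 'a \<Rightarrow> 'a) \<Rightarrow> 't set \<Rightarrow> ('a \<Rightarrow> complex) \<Rightarrow> 'a \<Rightarrow> complex" where
  "action_sum act S f = (\<lambda>z. \<Sum>t\<in>S. f (act t z))"

text \<open>Each \<open>t\<close> acts as an involution of \<open>V\<close>, so reindexing the sum
  over \<open>V\<close> by \<open>t\<close> moves it from \<open>f\<close> to
  \<open>g\<close>.\<close>

lemma symmetric_operator_action_sum:
  assumes "finite V"
    and inv: "\<And>t z. t \<in> S \<Longrightarrow> act t (act t z) = z"
    and closed: "\<And>t z. t \<in> S \<Longrightarrow> z \<in> V \<Longrightarrow> act t z \<in> V"
  shows "symmetric_operator V (supported V) (action_sum act S)"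
proof
  show "finite V" by fact
next
  fix f assume "f \<in> supported V"
  moreover have "act t z \<notin> V" if "t \<in> S" "z \<notin> V" for t z
    using inv[OF that(1), of z] closed[OF that(1), of "act t z"] that(2) by auto
  ultimately show "action_sum act S f \<in> supported V"
    by (simp add: supported_def action_sum_def)
next
  fix f g
  have "(\<Sum>z\<in>V. action_sum act S f z * cnj (g z)) = (\<Sum>t\<in>S. \<Sum>z\<in>V. f (act t z) * cnj (g z))"
    unfolding action_sum_def sum_distrib_right by (rule sum.swap)
  also have "\<dots> = (\<Sum>t\<in>S. \<Sum>z\<in>V. f z * cnj (g (act t z)))"
  proof (rule sum.cong[OF refl])
    fix t assume t: "t \<in> S"
    show "(\<Sum>z\<in>V. f (act t z) * cnj (g z)) = (\<Sum>z\<in>V. f z * cnj (g (act t z)))"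
      by (rule sum.reindex_bij_witness[where i = "act t" and j = "act t"])
        (simp_all add: t inv closed)
  qed
  also have "\<dots> = (\<Sum>z\<in>V. f z * cnj (action_sum act S g z))"
    unfolding action_sum_def cnj_sum sum_distrib_left by (rule sum.swap)
  finally show "(\<Sum>z\<in>V. action_sum act S f z * cnj (g z)) =
    (\<Sum>z\<in>V. f z * cnj (action_sum act S g z))" .
qed (auto simp: supported_def action_sum_def sum.distrib sum_distrib_left)

text \<open>\<open>A\<close> maps the eigenspace of \<open>B\<close> for \<open>b\<close> into
  itself because the operators commute, and it stays symmetric there, so it has an eigenvector in
  it.\<close>

lemma joint_eigenvector:
  assumes "symmetric_operator V W A" "symmetric_operator V W B"
    and commute: "\<And>g. g \<in> W \<Longrightarrow> A (B g) = B (A g)"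
    and f: "f \<in> W" "f \<noteq> (\<lambda>_. 0)" "B f = (\<lambda>z. b * f z)"
  obtains a g where "g \<in> W" "g \<noteq> (\<lambda>_. 0)" "A g = (\<lambda>z. a * g z)" "B g = (\<lambda>z. b * g z)"
proof -
  interpret A: symmetric_operator V W A by fact
  interpret B: symmetric_operator V W B by fact
  interpret E: symmetric_operator V "{g \<in> W. B g = (\<lambda>z. b * g z)}" A
  proof
    show "finite V" by (rule A.finite_V)
  next
    fix g h a assume "g \<in> {g \<in> W. B g = (\<lambda>z. b * g z)}" "h \<in> {g \<in> W. B g = (\<lambda>z. b * g z)}"
    then show "(\<lambda>z. a * g z + h z) \<in> {g \<in> W. B g = (\<lambda>z. b * g z)}"
      by (simp add: A.combination B.linear) (simp add: fun_eq_iff algebra_simps)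
  next
    fix g assume g: "g \<in> {g \<in> W. B g = (\<lambda>z. b * g z)}"
    then have gW: "g \<in> W" and Bg: "B g = (\<lambda>z. b * g z)" by auto
    have "B (A g) = A (B g)" by (rule commute[OF gW, symmetric])
    also have "\<dots> = (\<lambda>z. b * A g z)" by (simp only: Bg A.map_scale)
    finally show "A g \<in> {g \<in> W. B g = (\<lambda>z. b * g z)}" using A.invariant[OF gW] by simp
  next
    fix g z assume "g \<in> {g \<in> W. B g = (\<lambda>z. b * g z)}" "z \<notin> V"
    then show "g z = 0" using A.support by blast
  next
    show "A (\<lambda>z. a * g z + h z) = (\<lambda>z. a * A g z + A h z)" for a g h by (rule A.linear)
  next
    fix g h assume "g \<in> {g \<in> W. B g = (\<lambda>z. b * g z)}" "h \<in> {g \<in> W. B g = (\<lambda>z. b * g z)}"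
    then show "(\<Sum>z\<in>V. A g z * cnj (h z)) = (\<Sum>z\<in>V. g z * cnj (A h z))"
      using A.symmetric by blast
  qed
  show thesis
    using E.eigenvector_exists[of f] f that by blast
qed

text \<open>Vectors indexed by \<open>vs\<close> are functions on \<open>V\<close> read through the
  listing. The right-hand side does not mention \<open>vs\<close>, so every order of the vertices
  gives the same eigenvalues.\<close>

lemma eigenvalue_adjacency_matrix_iff:
  assumes vs: "distinct vs" "set vs = V"
  shows "eigenvalue (adjacency_matrix G vs) k \<longleftrightarrow>
    (\<exists>f\<in>supported V. f \<noteq> (\<lambda>_. 0) \<and> (\<forall>x\<in>V. (\<Sum>y\<in>V. if x \<rightarrow>\<^bsub>G\<^esub> y then f y else 0) = k * f x))"
proof -
  let ?n = "length vs" and ?A = "adjacency_matrix G vs"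
  have bij: "bij_betw ((!) vs) {..<?n} V"
    using vs by (intro bij_betw_nth) auto
  have mult: "(?A *\<^sub>v v) $ i = (\<Sum>y\<in>V. if vs ! i \<rightarrow>\<^bsub>G\<^esub> y then f y else 0)"
    if "i < ?n" "v \<in> carrier_vec ?n" "\<And>j. j < ?n \<Longrightarrow> v $ j = f (vs ! j)" for v f i
  proof -
    have "(?A *\<^sub>v v) $ i = (\<Sum>j<?n. if vs ! i \<rightarrow>\<^bsub>G\<^esub> vs ! j then f (vs ! j) else 0)"
    proof -
      have "(?A *\<^sub>v v) $ i = (\<Sum>j\<in>{0..<?n}. row ?A i $ j * v $ j)"
        using that(1,2) by (simp add: adjacency_matrix_def scalar_prod_def)
      also have "\<dots> = (\<Sum>j<?n. if vs ! i \<rightarrow>\<^bsub>G\<^esub> vs ! j then f (vs ! j) else 0)"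
        using that(1) unfolding atLeast0LessThan
        by (intro sum.cong) (simp_all add: adjacency_matrix_def that(3))
      finally show ?thesis .
    qed
    also have "\<dots> = (\<Sum>y\<in>V. if vs ! i \<rightarrow>\<^bsub>G\<^esub> y then f y else 0)"
      by (rule sum.reindex_bij_betw[OF bij])
    finally show ?thesis .
  qed
  have dim: "dim_row ?A = ?n" by (simp add: adjacency_matrix_def)
  show ?thesis
  proof
    assume "eigenvalue ?A k"
    then obtain v where v: "v \<in> carrier_vec ?n" "v \<noteq> 0\<^sub>v ?n" "?A *\<^sub>v v = k \<cdot>\<^sub>v v"
      unfolding eigenvalue_def eigenvector_def dim by blast
    define f where "f = (\<lambda>x. if x \<in> V then v $ the_inv_into {..<?n} ((!) vs) x else 0)"
    have f: "v $ j = f (vs ! j)" if "j < ?n" for j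
    proof -
      have "vs ! j \<in> V" using that vs by auto
      moreover have "the_inv_into {..<?n} ((!) vs) (vs ! j) = j"
        using that by (intro the_inv_into_f_f[OF bij_betw_imp_inj_on[OF bij]]) simp
      ultimately show ?thesis by (simp only: f_def if_True)
    qed
    have "(\<Sum>y\<in>V. if x \<rightarrow>\<^bsub>G\<^esub> y then f y else 0) = k * f x" if x: "x \<in> V" for x
    proof -
      obtain i where i: "i < ?n" "x = vs ! i" using x vs by (metis in_set_conv_nth)
      then show ?thesis
        using mult[OF i(1) v(1) f] f[OF i(1)] carrier_vecD[OF v(1)] unfolding v(3) by simp
    qed
    moreover have "f \<noteq> (\<lambda>_. 0)"
    proof
      assume "f = (\<lambda>_. 0)"
      have "v = 0\<^sub>v ?n"
      proof (rule eq_vecI)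
        fix j assume "j < dim_vec (0\<^sub>v ?n :: complex vec)"
        then show "v $ j = 0\<^sub>v ?n $ j" by (simp add: f \<open>f = (\<lambda>_. 0)\<close>)
      qed (simp add: carrier_vecD[OF v(1)])
      with v(2) show False by contradiction
    qed
    moreover have "f \<in> supported V" by (simp add: f_def supported_def)
    ultimately show "\<exists>f\<in>supported V. f \<noteq> (\<lambda>_. 0) \<and>
        (\<forall>x\<in>V. (\<Sum>y\<in>V. if x \<rightarrow>\<^bsub>G\<^esub> y then f y else 0) = k * f x)"
      by blast
  next
    assume "\<exists>f\<in>supported V. f \<noteq> (\<lambda>_. 0) \<and>
        (\<forall>x\<in>V. (\<Sum>y\<in>V. if x \<rightarrow>\<^bsub>G\<^esub> y then f y else 0) = k * f x)"
    then obtain f where f: "f \<in> supported V" "f \<noteq> (\<lambda>_. 0)"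
      "\<And>x. x \<in> V \<Longrightarrow> (\<Sum>y\<in>V. if x \<rightarrow>\<^bsub>G\<^esub> y then f y else 0) = k * f x" by blast
    define v where "v = vec ?n (\<lambda>i. f (vs ! i))"
    have v: "v \<in> carrier_vec ?n" "\<And>j. j < ?n \<Longrightarrow> v $ j = f (vs ! j)" by (simp_all add: v_def)
    obtain x where x: "f x \<noteq> 0" using f(2) by auto
    then have "x \<in> set vs" using f(1) vs by (auto simp: supported_def)
    then obtain i where "i < ?n" "x = vs ! i" by (metis in_set_conv_nth)
    then have "v \<noteq> 0\<^sub>v ?n" using x v(2) by auto
    moreover have "?A *\<^sub>v v = k \<cdot>\<^sub>v v"
    proof (rule eq_vecI)
      fix i assume "i < dim_vec (k \<cdot>\<^sub>v v)"
      then have i: "i < ?n" by (simp add: v_def)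
      then have "vs ! i \<in> V" using vs by auto
      then show "(?A *\<^sub>v v) $ i = (k \<cdot>\<^sub>v v) $ i"
        using mult[OF i v] f(3) v(2)[OF i] i v(1) by simp
    qed (simp add: v_def dim)
    ultimately show "eigenvalue ?A k"
      unfolding eigenvalue_def eigenvector_def dim using v(1) by blast
  qed
qed

section \<open>Transpositions as involutions, and the Cayley graph\<close>

lemma transpositionsE:
  assumes "t \<in> transpositions n"
  obtains i j where "t = Transposition.transpose i j" "i \<in> {1..n}" "j \<in> {1..n}" "i \<noteq> j"
  using assms unfolding transpositions_def by blast

lemma transposition_permutes:
  assumes "t \<in> transpositions n"
  shows "t permutes {1..n}" "t (t i) = i" "i \<in> {1..n} \<Longrightarrow> t i \<in> {1..n}"
proof -
  obtain i j where t: "t = Transposition.transpose i j" "i \<in> {1..n}" "j \<in> {1..n}"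
    using assms by (rule transpositionsE)
  then show p: "t permutes {1..n}" by (simp only: permutes_swap_id)
  show "t (t i) = i" for i using t by simp
  show "i \<in> {1..n} \<Longrightarrow> t i \<in> {1..n}" for i using permutes_in_image[OF p] by blast
qed

lemma symmetric_operator_transpositions:
  assumes "T \<subseteq> transpositions n"
  defines "P \<equiv> {p. p permutes {1..n}}"
  shows "symmetric_operator P (supported P) (action_sum (\<circ>) T)"
  unfolding P_def
proof (rule symmetric_operator_action_sum)
  show "finite {p. p permutes {1..n}}" by (simp add: finite_permutations)
next
  fix t and z :: "nat \<Rightarrow> nat" assume "t \<in> T"
  then have "t \<in> transpositions n" using assms(1) by blast
  then show "t \<circ> (t \<circ> z) = z" by (simp add: fun_eq_iff transposition_permutes)
next
  fix t z assume "t \<in> T" "z \<in> {p. p permutes {1..n}}"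
  then have "t \<in> transpositions n" using assms(1) by blast
  from transposition_permutes(1)[OF this] \<open>z \<in> _\<close>
  show "t \<circ> z \<in> {p. p permutes {1..n}}" using permutes_compose by blast
qed

lemma integral_cayley_graph_iff:
  assumes T: "T \<subseteq> transpositions n"
  shows "integral_graph (cayley_graph (sym_group n) T) \<longleftrightarrow>
    integral_operator (supported {p. p permutes {1..n}}) (action_sum (\<circ>) T)"
proof -
  let ?G = "cayley_graph (sym_group n) T" and ?P = "{p. p permutes {1..n}}"
  have verts: "verts ?G = ?P" by (simp add: cayley_graph_def sym_group_def)
  have fin: "finite ?P" by (simp add: finite_permutations)
  have perm: "t permutes {1..n}" if "t \<in> T" for t
    using that T transposition_permutes(1) by blast
  have inv: "inv' t = t" if t: "t \<in> T" for t
  proof -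
    obtain i j where "t = Transposition.transpose i j"
      using T t by (blast elim: transpositionsE)
    then show ?thesis by simp
  qed
  have adj: "g \<rightarrow>\<^bsub>?G\<^esub> h \<longleftrightarrow> g \<circ> inv' h \<in> T" if "g \<in> ?P" "h \<in> ?P" for g h
    using that sym_group_inv_equality[of h n]
    by (simp add: cayley_graph_def arcs_ends_conv sym_group_carrier sym_group_mult)
  have sum_adj: "(\<Sum>h\<in>?P. if g \<rightarrow>\<^bsub>?G\<^esub> h then f h else 0) = action_sum (\<circ>) T f g"
    if g: "g \<in> ?P" for f :: "(nat \<Rightarrow> nat) \<Rightarrow> complex" and g
  proof -
    have bij: "bij g" using g by (auto intro: permutes_bij)
    \<comment> \<open>The neighbours of \<open>g\<close>: \<open>g \<circ> inv' h = t\<close> means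
      \<open>h = inv' t \<circ> g\<close>, and \<open>t\<close> is its own inverse.\<close>
    have "{h \<in> ?P. g \<rightarrow>\<^bsub>?G\<^esub> h} = (\<lambda>t. t \<circ> g) ` T"
    proof (intro equalityI subsetI)
      fix h assume "h \<in> {h \<in> ?P. g \<rightarrow>\<^bsub>?G\<^esub> h}"
      then have h: "h \<in> ?P" "g \<circ> inv' h \<in> T" using adj g by auto
      then have "bij h" by (auto intro: permutes_bij)
      have "inv' (g \<circ> inv' h) = h \<circ> inv' g"
        using \<open>bij h\<close> bij by (simp add: o_inv_distrib bij_imp_bij_inv inv_inv_eq)
      then have "h \<circ> inv' g = g \<circ> inv' h" using inv[OF h(2)] by simp
      then have "(g \<circ> inv' h) \<circ> g = h \<circ> (inv' g \<circ> g)" by (metis comp_assoc)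
      then have "(g \<circ> inv' h) \<circ> g = h" using bij by (simp add: bij_is_inj)
      with h(2) show "h \<in> (\<lambda>t. t \<circ> g) ` T" by (metis image_eqI)
    next
      fix h assume "h \<in> (\<lambda>t. t \<circ> g) ` T"
      then obtain t where t: "t \<in> T" "h = t \<circ> g" by blast
      then have hP: "h \<in> ?P" using perm g by (auto intro: permutes_compose)
      have "bij t" using perm[OF t(1)] by (rule permutes_bij)
      then have "inv' h = inv' g \<circ> t"
        using t bij by (simp add: o_inv_distrib inv)
      moreover have "g \<circ> inv' g = id" using bij by (simp add: bij_is_surj flip: surj_iff)
      ultimately have "g \<circ> inv' h = t" by (metis comp_assoc id_comp)
      with t(1) hP show "h \<in> {h \<in> ?P. g \<rightarrow>\<^bsub>?G\<^esub> h}" using adj[OF g hP] by simp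
    qed
    moreover have "inj_on (\<lambda>t. t \<circ> g) T"
      using bij by (intro inj_onI) (metis bij_is_surj o_inv_o_cancel comp_assoc surj_iff comp_id)
    ultimately show ?thesis
      unfolding action_sum_def sum.inter_filter[OF fin, symmetric] by (simp add: sum.reindex)
  qed
  interpret symmetric_operator ?P "supported ?P" "action_sum (\<circ>) T"
    by (rule symmetric_operator_transpositions[OF T])
  \<comment> \<open>Both sides vanish outside the permutations, so equality at all vertices is
    equality of functions.\<close>
  have eig: "(\<forall>g\<in>?P. (\<Sum>h\<in>?P. if g \<rightarrow>\<^bsub>?G\<^esub> h then f h else 0) = k * f g) \<longleftrightarrow>
    action_sum (\<circ>) T f = (\<lambda>g. k * f g)" if "f \<in> supported ?P" for k f
  proof -
    have "action_sum (\<circ>) T f g = k * f g" if "g \<notin> ?P" for g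
      using support[OF \<open>f \<in> supported ?P\<close> that] support[OF invariant[OF \<open>f \<in> supported ?P\<close>] that]
      by simp
    then show ?thesis using sum_adj by (auto simp: fun_eq_iff)
  qed
  \<comment> \<open>Integrality quantifies over all listings of the vertices; one listing must exist
    for it to constrain the eigenvalues.\<close>
  obtain vs where "distinct vs" "set vs = ?P"
    using finite_distinct_list[OF fin] by blast
  then show ?thesis
    unfolding integral_graph_def integral_operator_def verts
    using eig by (auto simp: graph_cayley_graph_transpositions[OF T] eigenvalue_adjacency_matrix_iff)
qed

section \<open>Jucys-Murphy elements and complete vertices\<close>

lemma conj_transpose: "inj t \<Longrightarrow> t \<circ> Transposition.transpose a b = Transposition.transpose (t a) (t b) \<circ> t"
  by (auto simp: fun_eq_iff Transposition.transpose_def inj_eq)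

lemma inj_on_transpose: "inj_on (Transposition.transpose v) U"
  by (rule inj_onI) (metis transpose_apply_first)

lemma action_sum_star:
  "action_sum (\<circ>) (Transposition.transpose v ` U) f = (\<lambda>g. \<Sum>u\<in>U. f (Transposition.transpose v u \<circ> g))"
  by (simp add: action_sum_def sum.reindex[OF inj_on_transpose])

text \<open>Conjugation by \<open>t\<close> turns the transposition of \<open>v\<close> and
  \<open>u\<close> into that of \<open>v\<close> and \<open>t u\<close>; as \<open>t\<close>
  permutes \<open>U\<close>, this only reorders the sum over \<open>U\<close>.\<close>

lemma action_sum_star_commute:
  assumes "\<And>t. t \<in> T \<Longrightarrow> t v = v" "\<And>t. t \<in> T \<Longrightarrow> inj t" "\<And>t. t \<in> T \<Longrightarrow> bij_betw t U U"
  shows "action_sum (\<circ>) T (action_sum (\<circ>) (Transposition.transpose v ` U) f) =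
    action_sum (\<circ>) (Transposition.transpose v ` U) (action_sum (\<circ>) T f)"
proof
  fix g
  have "action_sum (\<circ>) T (action_sum (\<circ>) (Transposition.transpose v ` U) f) g =
      (\<Sum>t\<in>T. \<Sum>u\<in>U. f (Transposition.transpose v u \<circ> (t \<circ> g)))"
    unfolding action_sum_star by (simp add: action_sum_def)
  also have "\<dots> = (\<Sum>t\<in>T. \<Sum>u\<in>U. f (t \<circ> (Transposition.transpose v u \<circ> g)))"
  proof (rule sum.cong[OF refl])
    fix t assume t: "t \<in> T"
    have "(\<Sum>u\<in>U. f (Transposition.transpose v u \<circ> (t \<circ> g))) =
        (\<Sum>u\<in>U. f (Transposition.transpose v (t u) \<circ> (t \<circ> g)))"
      by (rule sum.reindex_bij_betw[OF assms(3)[OF t], symmetric])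
    also have "\<dots> = (\<Sum>u\<in>U. f (t \<circ> (Transposition.transpose v u \<circ> g)))"
      using conj_transpose[OF assms(2)[OF t], of v] assms(1)[OF t]
      by (simp flip: comp_assoc)
    finally show "(\<Sum>u\<in>U. f (Transposition.transpose v u \<circ> (t \<circ> g))) =
        (\<Sum>u\<in>U. f (t \<circ> (Transposition.transpose v u \<circ> g)))" .
  qed
  also have "\<dots> = (\<Sum>u\<in>U. \<Sum>t\<in>T. f (t \<circ> (Transposition.transpose v u \<circ> g)))"
    by (rule sum.swap)
  also have "\<dots> = action_sum (\<circ>) (Transposition.transpose v ` U) (action_sum (\<circ>) T f) g"
    unfolding action_sum_star by (simp add: action_sum_def)
  finally show "action_sum (\<circ>) T (action_sum (\<circ>) (Transposition.transpose v ` U) f) g =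
    action_sum (\<circ>) (Transposition.transpose v ` U) (action_sum (\<circ>) T f) g" .
qed

lemma star_subset_transpositions:
  "U \<subseteq> {1..n} \<Longrightarrow> v \<in> {1..n} - U \<Longrightarrow> Transposition.transpose v ` U \<subseteq> transpositions n"
  unfolding transpositions_def by blast

text \<open>
  Adding a point \<open>w\<close> changes the Jucys-Murphy element \<open>A\<close> at \<open>w\<close> into \<open>B = s A s + s\<close> at \<open>v\<close>, where
  \<open>s = (v w)\<close>. For a joint eigenvector \<open>g\<close> with eigenvalues \<open>a\<close> of \<open>A\<close> and \<open>k\<close> of \<open>B\<close>, the span of \<open>g\<close> and
  \<open>s g\<close> is invariant under \<open>A\<close> and \<open>k\<close> is another eigenvalue of \<open>A\<close> there, unless \<open>s g = \<plusminus>g\<close>, in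
  which case \<open>k = a \<plusminus> 1\<close>.
\<close>

lemma integral_operator_star:
  fixes n :: nat
  assumes "finite U" "U \<subseteq> {1..n}" "v \<in> {1..n} - U"
  shows "integral_operator (supported {p. p permutes {1..n}})
    (action_sum (\<circ>) (Transposition.transpose v ` U))"
  using assms
proof (induction U arbitrary: v rule: finite_induct)
  case empty
  show ?case
    unfolding integral_operator_def by (auto simp: action_sum_def fun_eq_iff)
next
  case (insert w U)
  let ?P = "{p. p permutes {1..n}}"
  let ?tr = "Transposition.transpose :: nat \<Rightarrow> nat \<Rightarrow> nat \<Rightarrow> nat"
  let ?A = "action_sum (\<circ>) (?tr w ` U)"
  let ?B = "action_sum (\<circ>) (?tr v ` insert w U)"
  let ?s = "?tr v w"
  have w: "w \<in> {1..n} - U" and U: "U \<subseteq> {1..n}" using insert by auto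
  have v: "v \<noteq> w" "v \<notin> U" using insert.prems by auto
  have IH: "k \<in> \<int>" if "f \<in> supported ?P" "f \<noteq> (\<lambda>_. 0)" "?A f = (\<lambda>z. k * f z)" for k f
    using insert.IH[OF U w] that unfolding integral_operator_def by blast
  have symA: "symmetric_operator ?P (supported ?P) ?A"
    by (intro symmetric_operator_transpositions star_subset_transpositions U w)
  have symB: "symmetric_operator ?P (supported ?P) ?B"
    by (intro symmetric_operator_transpositions star_subset_transpositions insert.prems)
  interpret A: symmetric_operator ?P "supported ?P" ?A by (rule symA)
  \<comment> \<open>The transpositions in \<open>?A\<close> fix \<open>v\<close> and permute
    \<open>insert w U\<close>. Commutation lets an eigenvector of \<open>?B\<close> be replaced by a
    joint one.\<close>
  have commute: "?A (?B f) = ?B (?A f)" for f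
  proof (rule action_sum_star_commute)
    fix t assume "t \<in> ?tr w ` U"
    then obtain u where u: "t = ?tr w u" "u \<in> U" by blast
    with v have "v \<noteq> u" by blast
    then show "t v = v" using u(1) v(1) by simp
    show "inj t" using u(1) by simp
    have "t permutes insert w U" using u by (auto intro!: permutes_swap_id)
    then show "bij_betw t (insert w U) (insert w U)" by (rule permutes_imp_bij)
  qed
  show ?case
    unfolding integral_operator_def
  proof (intro allI impI; elim conjE)
    fix k f assume f: "f \<in> supported ?P" "f \<noteq> (\<lambda>_. 0)" "?B f = (\<lambda>z. k * f z)"
    obtain a g where g: "g \<in> supported ?P" "g \<noteq> (\<lambda>_. 0)" "?A g = (\<lambda>z. a * g z)" "?B g = (\<lambda>z. k * g z)"
      using joint_eigenvector[OF symA symB commute f] by blast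
    have a: "a \<in> \<int>" using IH g by blast
    define h where "h = (\<lambda>p. g (?s \<circ> p))"
    have ss: "?s \<circ> (?s \<circ> p) = p" for p :: "nat \<Rightarrow> nat" by (simp add: fun_eq_iff)
    have s: "?s \<in> transpositions n" using insert.prems v w unfolding transpositions_def by blast
    have "?s \<circ> p \<notin> ?P" if "p \<notin> ?P" for p
      using that ss[of p] transposition_permutes(1)[OF s] permutes_compose by (metis mem_Collect_eq)
    then have h: "h \<in> supported ?P" using g(1) unfolding supported_def h_def by blast
    \<comment> \<open>Evaluate \<open>?B g\<close> at \<open>?s \<circ> p\<close>: the summand for
      \<open>w\<close> is \<open>g p\<close>, and moving \<open>?s\<close> to the left past the
      transposition of \<open>v\<close> and \<open>u\<close> turns that into the transposition of
      \<open>w\<close> and \<open>u\<close>.\<close>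
    have Ah: "?A h p = k * h p - g p" for p
    proof -
      have "?tr v u \<circ> (?s \<circ> p) = ?s \<circ> (?tr w u \<circ> p)" if "u \<in> U" for u
        using that v w insert.hyps by (auto simp: fun_eq_iff Transposition.transpose_def)
      then have "?B g (?s \<circ> p) = g p + ?A h p"
        unfolding action_sum_star using insert.hyps by (simp add: h_def ss)
      then show ?thesis using g(4) by (simp add: h_def)
    qed
    show "k \<in> \<int>"
    proof (cases "a = k")
      case False
      \<comment> \<open>\<open>?A\<close> sends \<open>c g + h\<close> to
        \<open>(c a - 1) g + k h\<close>, which is \<open>k (c g + h)\<close> if
        \<open>c (a - k) = 1\<close>.\<close>
      define c where "c = 1 / (a - k)"
      have c: "c * a = c * k + 1" using False by (simp add: c_def field_simps)
      define y where "y = (\<lambda>p. c * g p + h p)"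
      have y: "y \<in> supported ?P" unfolding y_def by (rule A.combination[OF g(1) h])
      have "?A y = (\<lambda>p. c * a * g p + (k * h p - g p))"
        unfolding y_def A.linear g(3) by (simp add: Ah fun_eq_iff)
      then have Ay: "?A y = (\<lambda>p. k * y p)"
        unfolding c y_def by (simp add: fun_eq_iff algebra_simps)
      show ?thesis
      proof (cases "y = (\<lambda>_. 0)")
        case True
        then have eq: "g (?s \<circ> p) = - c * g p" for p
          by (auto simp: y_def h_def fun_eq_iff eq_neg_iff_add_eq_0 add.commute)
        obtain p where p: "g p \<noteq> 0" using g(2) by auto
        have "g p = - c * (- c * g p)" using eq[of "?s \<circ> p"] eq[of p] by (simp add: ss)
        then have "c * c = 1" using p by simp
        then have "c = 1 \<or> c = - 1" by (simp add: square_eq_1_iff)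
        then have "a - k = 1 \<or> a - k = - 1" using c by (auto simp: algebra_simps)
        then have "k = a - 1 \<or> k = a + 1" by (auto simp: algebra_simps)
        with a show ?thesis by auto
      qed (use IH[OF y _ Ay] in blast)
    qed (use a in blast)
  qed
qed

text \<open>An eigenvector of either operator can be replaced by one for the same eigenvalue that is
  also an eigenvector of \<open>?J\<close>; there the eigenvalues of the two operators differ by an
  eigenvalue of \<open>?J\<close>, an integer.\<close>

lemma integral_operator_complete_vertex_iff:
  assumes T: "T \<subseteq> transpositions n" and v: "v \<in> {1..n}"
    and star: "Transposition.transpose v ` ({1..n} - {v}) \<subseteq> T"
  defines "W \<equiv> supported {p. p permutes {1..n}}"
  shows "integral_operator W (action_sum (\<circ>) T) \<longleftrightarrow>
    integral_operator W (action_sum (\<circ>) {t \<in> T. t v = v})"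
proof -
  let ?S = "Transposition.transpose v ` ({1..n} - {v})" and ?T' = "{t \<in> T. t v = v}"
  let ?J = "action_sum (\<circ>) ?S"
  have "T \<subseteq> {p. p permutes {1..n}}" using T transposition_permutes(1) by blast
  then have finT: "finite T" by (rule finite_subset) (simp add: finite_permutations)
  have "T = ?S \<union> ?T'"
  proof (intro equalityI subsetI)
    fix t assume t: "t \<in> T"
    then obtain i j where ij: "t = Transposition.transpose i j" "i \<in> {1..n}" "j \<in> {1..n}" "i \<noteq> j"
      using T by (blast elim: transpositionsE)
    show "t \<in> ?S \<union> ?T'"
    proof (cases "i = v \<or> j = v")
      case True
      then have "t = Transposition.transpose v (if i = v then j else i)"
        using ij(1) by (auto simp: transpose_commute)
      moreover have "(if i = v then j else i) \<in> {1..n} - {v}" using ij True by auto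
      ultimately show ?thesis by blast
    qed (use t ij in auto)
  qed (use star in auto)
  moreover have "?S \<inter> ?T' = {}" by auto
  ultimately have sum: "action_sum (\<circ>) T f = (\<lambda>g. ?J f g + action_sum (\<circ>) ?T' f g)" for f
    using finT unfolding action_sum_def by (metis (no_types, lifting) sum.union_disjoint finite_Un)
  have T': "?T' \<subseteq> transpositions n" using T by blast
  have S: "?S \<subseteq> transpositions n" using star T by blast
  have symT: "symmetric_operator {p. p permutes {1..n}} W (action_sum (\<circ>) T)"
    and symT': "symmetric_operator {p. p permutes {1..n}} W (action_sum (\<circ>) ?T')"
    and symJ: "symmetric_operator {p. p permutes {1..n}} W ?J"
    unfolding W_def by (rule symmetric_operator_transpositions, fact)+
  interpret J: symmetric_operator "{p. p permutes {1..n}}" W ?J by (rule symJ)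
  have commute': "?J (action_sum (\<circ>) ?T' f) = action_sum (\<circ>) ?T' (?J f)" for f
  proof (rule action_sum_star_commute[symmetric])
    fix t assume "t \<in> ?T'"
    then have t: "t v = v" "t permutes {1..n}" using T transposition_permutes(1) by auto
    from t(1) show "t v = v" .
    show inj: "inj t" using t(2) by (rule permutes_inj)
    have "t ` ({1..n} - {v}) = {1..n} - {v}"
      using image_set_diff[OF inj, of "{1..n}" "{v}"] permutes_image[OF t(2)] t(1) by simp
    then show "bij_betw t ({1..n} - {v}) ({1..n} - {v})"
      using inj unfolding bij_betw_def by (metis inj_on_subset subset_UNIV)
  qed
  have commute: "?J (action_sum (\<circ>) T f) = action_sum (\<circ>) T (?J f)" for f :: "(nat \<Rightarrow> nat) \<Rightarrow> complex"
    unfolding sum J.map_add commute' ..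
  have J: "k \<in> \<int>" if "f \<in> W" "f \<noteq> (\<lambda>_. 0)" "?J f = (\<lambda>z. k * f z)" for k f
    using integral_operator_star[of "{1..n} - {v}" n v] v that
    unfolding integral_operator_def W_def by blast
  show ?thesis
  proof
    assume int: "integral_operator W (action_sum (\<circ>) T)"
    show "integral_operator W (action_sum (\<circ>) ?T')"
      unfolding integral_operator_def
    proof (intro allI impI; elim conjE)
      fix k f assume f: "f \<in> W" "f \<noteq> (\<lambda>_. 0)" "action_sum (\<circ>) ?T' f = (\<lambda>z. k * f z)"
      obtain j g where g: "g \<in> W" "g \<noteq> (\<lambda>_. 0)" "?J g = (\<lambda>z. j * g z)"
        "action_sum (\<circ>) ?T' g = (\<lambda>z. k * g z)"
        using joint_eigenvector[OF symJ symT' commute' f] by blast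
      have "action_sum (\<circ>) T g = (\<lambda>z. (j + k) * g z)"
        unfolding sum g(3,4) by (simp add: algebra_simps)
      then have "j + k \<in> \<int>" using int g unfolding integral_operator_def by blast
      then have "j + k - j \<in> \<int>" using J[OF g(1-3)] by (rule Ints_diff)
      then show "k \<in> \<int>" by simp
    qed
  next
    assume int: "integral_operator W (action_sum (\<circ>) ?T')"
    show "integral_operator W (action_sum (\<circ>) T)"
      unfolding integral_operator_def
    proof (intro allI impI; elim conjE)
      fix k f assume f: "f \<in> W" "f \<noteq> (\<lambda>_. 0)" "action_sum (\<circ>) T f = (\<lambda>z. k * f z)"
      obtain j g where g: "g \<in> W" "g \<noteq> (\<lambda>_. 0)" "?J g = (\<lambda>z. j * g z)"
        "action_sum (\<circ>) T g = (\<lambda>z. k * g z)"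
        using joint_eigenvector[OF symJ symT commute f] by blast
      have "action_sum (\<circ>) ?T' g = (\<lambda>z. (k - j) * g z)"
        using g(4) unfolding sum g(3) by (auto simp: fun_eq_iff algebra_simps)
      then have "k - j \<in> \<int>" using int g unfolding integral_operator_def by blast
      then have "k - j + j \<in> \<int>" using J[OF g(1-3)] by (rule Ints_add)
      then show "k \<in> \<int>" by simp
    qed
  qed
qed

section \<open>The natural representation and the spectral gap\<close>

lemma symmetric_operator_natural:
  assumes "T \<subseteq> transpositions n"
  shows "symmetric_operator {1..n} (supported {1..n}) (action_sum (\<lambda>t. t) T)"
  by (rule symmetric_operator_action_sum) (use assms transposition_permutes in blast)+

lemma integral_operator_natural:
  assumes T: "T \<subseteq> transpositions n"
    and int: "integral_operator (supported {p. p permutes {1..n}}) (action_sum (\<circ>) T)"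
  shows "integral_operator (supported {1..n}) (action_sum (\<lambda>t. t) T)"
  unfolding integral_operator_def
proof (intro allI impI; elim conjE)
  fix k x assume x: "x \<in> supported {1..n}" "x \<noteq> (\<lambda>_. 0)" "action_sum (\<lambda>t. t) T x = (\<lambda>i. k * x i)"
  let ?P = "{p. p permutes {1..n}}"
  interpret symmetric_operator ?P "supported ?P" "action_sum (\<circ>) T"
    by (rule symmetric_operator_transpositions[OF T])
  obtain i where i: "x i \<noteq> 0" using x(2) by auto
  then have in_n: "i \<in> {1..n}" using x(1) by (auto simp: supported_def)
  then have one: "1 \<in> {1..n}" by simp
  define f where "f = (\<lambda>g. if g \<in> ?P then x (g 1) else 0)"
  have f: "f \<in> supported ?P" by (simp add: f_def supported_def)
  \<comment> \<open>This permutation carries 1 to \<open>i\<close>, so \<open>f\<close> takes the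
    nonzero value \<open>x i\<close> there.\<close>
  have "Transposition.transpose 1 i \<in> ?P"
    unfolding mem_Collect_eq by (rule permutes_swap_id[OF one in_n])
  then have "f (Transposition.transpose 1 i) = x i" by (simp only: f_def if_True) simp
  then have "f \<noteq> (\<lambda>_. 0)" using i by auto
  moreover have "action_sum (\<circ>) T f = (\<lambda>g. k * f g)"
  proof
    fix g
    show "action_sum (\<circ>) T f g = k * f g"
    proof (cases "g \<in> ?P")
      case True
      have "t \<circ> g \<in> ?P" if "t \<in> T" for t
        using that T True transposition_permutes(1) permutes_compose by blast
      then have "action_sum (\<circ>) T f g = action_sum (\<lambda>t. t) T x (g 1)"
        unfolding action_sum_def by (intro sum.cong) (simp_all only: f_def if_True comp_apply)
      also have "\<dots> = k * f g" using True by (simp only: x(3) f_def if_True)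
      finally show ?thesis .
    next
      case False
      then show ?thesis using support[OF f] support[OF invariant[OF f]] by simp
    qed
  qed
  ultimately show "k \<in> \<int>" using int f unfolding integral_operator_def by blast
qed

text \<open>The quadratic form of the Laplacian
  \<open>card T - action_sum (\<lambda>t. t) T\<close>. The inner sum meets both points moved by
  \<open>t\<close>, so every edge is counted twice; this is the factor 2. Expand the square and use
  that \<open>t\<close> permutes \<open>{1..n}\<close>.\<close>

lemma dirichlet_form:
  assumes T: "T \<subseteq> transpositions n"
  shows "(\<Sum>t\<in>T. \<Sum>i\<in>{1..n}. (cmod (f i - f (t i)))\<^sup>2) =
    2 * (card T * (\<Sum>i\<in>{1..n}. (cmod (f i))\<^sup>2) -
      Re (\<Sum>i\<in>{1..n}. action_sum (\<lambda>t. t) T f i * cnj (f i)))"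
proof -
  let ?N = "\<Sum>i\<in>{1..n}. (cmod (f i))\<^sup>2"
  have "(\<Sum>i\<in>{1..n}. (cmod (f i - f (t i)))\<^sup>2) =
      2 * ?N - 2 * (\<Sum>i\<in>{1..n}. Re (f (t i) * cnj (f i)))" if t: "t \<in> T" for t
  proof -
    have "t permutes {1..n}" using t T transposition_permutes(1) by blast
    then have "(\<Sum>i\<in>{1..n}. (cmod (f (t i)))\<^sup>2) = ?N"
      by (intro sum.reindex_bij_betw permutes_imp_bij)
    moreover have "(cmod (a - b))\<^sup>2 = (cmod a)\<^sup>2 + (cmod b)\<^sup>2 - 2 * Re (b * cnj a)" for a b
      unfolding cmod_power2 by (simp add: power2_eq_square algebra_simps)
    ultimately show ?thesis by (simp add: sum.distrib sum_subtractf sum_distrib_left)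
  qed
  then have "(\<Sum>t\<in>T. \<Sum>i\<in>{1..n}. (cmod (f i - f (t i)))\<^sup>2) =
      2 * (card T * ?N) - 2 * (\<Sum>t\<in>T. \<Sum>i\<in>{1..n}. Re (f (t i) * cnj (f i)))"
    by (simp add: sum_subtractf sum_distrib_left mult.left_commute)
  also have "(\<Sum>t\<in>T. \<Sum>i\<in>{1..n}. Re (f (t i) * cnj (f i))) =
      (\<Sum>i\<in>{1..n}. \<Sum>t\<in>T. Re (f (t i) * cnj (f i)))" by (rule sum.swap)
  also have "\<dots> = Re (\<Sum>i\<in>{1..n}. action_sum (\<lambda>t. t) T f i * cnj (f i))"
    by (simp only: action_sum_def sum_distrib_right Re_sum)
  finally show ?thesis by (simp only: right_diff_distrib)
qed

text \<open>Integrality gives a spectral gap. The hypothesis \<open>conn\<close> expresses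
  connectedness through invariant functions: an eigenvector for \<open>card T\<close> is constant,
  hence orthogonal to \<open>x\<close>, whose sum is 0. The other eigenvalues are integers below
  \<open>card T\<close>, so at most \<open>card T - 1\<close>.\<close>

lemma integral_dirichlet_ge:
  assumes T: "T \<subseteq> transpositions n"
    and int: "integral_operator (supported {1..n}) (action_sum (\<lambda>t. t) T)"
    and conn: "\<And>f :: nat \<Rightarrow> complex. (\<And>t i. t \<in> T \<Longrightarrow> i \<in> {1..n} \<Longrightarrow> f (t i) = f i) \<Longrightarrow>
      \<exists>c. \<forall>i\<in>{1..n}. f i = c"
    and x: "x \<in> supported {1..n}" "(\<Sum>i\<in>{1..n}. x i) = 0"
  shows "2 * (\<Sum>i\<in>{1..n}. (cmod (x i))\<^sup>2) \<le> (\<Sum>t\<in>T. \<Sum>i\<in>{1..n}. (cmod (x i - x (t i)))\<^sup>2)"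
proof -
  let ?M = "action_sum (\<lambda>t. t) T"
  have "T \<subseteq> {p. p permutes {1..n}}" using T transposition_permutes(1) by blast
  then have finT: "finite T" by (rule finite_subset) (simp add: finite_permutations)
  interpret symmetric_operator "{1..n}" "supported {1..n}" ?M
    by (rule symmetric_operator_natural[OF T])
  have "Re (\<Sum>i\<in>{1..n}. ?M x i * cnj (x i)) \<le> (real (card T) - 1) * (\<Sum>i\<in>{1..n}. (cmod (x i))\<^sup>2)"
  proof (rule rayleigh_le[OF x(1)])
    fix k g assume g: "g \<in> supported {1..n}" "g \<noteq> (\<lambda>_. 0)" "?M g = (\<lambda>i. k * g i)"
      and gx: "(\<Sum>i\<in>{1..n}. g i * cnj (x i)) \<noteq> 0"
    let ?N = "\<Sum>i\<in>{1..n}. (cmod (g i))\<^sup>2" and ?E = "\<Sum>t\<in>T. \<Sum>i\<in>{1..n}. (cmod (g i - g (t i)))\<^sup>2"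
    obtain m where m: "k = of_int m"
      using int g unfolding integral_operator_def by (blast elim: Ints_cases)
    have "(\<Sum>i\<in>{1..n}. ?M g i * cnj (g i)) = of_real (of_int m * ?N)"
      unfolding g(3) m of_real_mult of_real_sum complex_norm_square
      by (simp add: sum_distrib_left mult.assoc)
    \<comment> \<open>On an eigenvector the Dirichlet form is a positive multiple of
      \<open>card T - m\<close>, so its positivity bounds \<open>m\<close>.\<close>
    then have E: "?E = 2 * ((real (card T) - of_int m) * ?N)"
      unfolding dirichlet_form[OF T] by (simp add: left_diff_distrib)
    have "?N \<noteq> 0" using norm_sum_eq_0[OF g(1)] g(2)
      by (metis (no_types, lifting) complex_norm_square of_real_0 of_real_sum sum.cong)
    then have N: "?N > 0" using sum_nonneg[of "{1..n}" "\<lambda>i. (cmod (g i))\<^sup>2"] by force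
    have "?E \<noteq> 0"
    proof
      assume "?E = 0"
      then have "\<forall>t\<in>T. (\<Sum>i\<in>{1..n}. (cmod (g i - g (t i)))\<^sup>2) = 0"
        by (subst (asm) sum_nonneg_eq_0_iff[OF finT]) (simp_all add: sum_nonneg)
      then have "g (t i) = g i" if "t \<in> T" "i \<in> {1..n}" for t i
        using that by (simp add: sum_nonneg_eq_0_iff)
      then obtain c where "\<forall>i\<in>{1..n}. g i = c" using conn by blast
      then have "(\<Sum>i\<in>{1..n}. g i * cnj (x i)) = c * cnj (\<Sum>i\<in>{1..n}. x i)"
        by (simp add: sum_distrib_left)
      with gx x(2) show False by simp
    qed
    moreover have "?E \<ge> 0" by (intro sum_nonneg) simp
    ultimately have "0 < (real (card T) - of_int m) * ?N" unfolding E by linarith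
    then have "real (card T) - of_int m > 0" using N by (rule zero_less_mult_pos2)
    then have "m < int (card T)" by linarith
    then show "Re k \<le> real (card T) - 1" unfolding m by simp
  qed
  then show ?thesis unfolding dirichlet_form[OF T] by (simp add: left_diff_distrib)
qed

lemma separating_vertex_complete:
  assumes T: "T \<subseteq> transpositions n"
    and int: "integral_operator (supported {1..n}) (action_sum (\<lambda>t. t) T)"
    and conn: "\<And>f :: nat \<Rightarrow> complex. (\<And>t i. t \<in> T \<Longrightarrow> i \<in> {1..n} \<Longrightarrow> f (t i) = f i) \<Longrightarrow>
      \<exists>c. \<forall>i\<in>{1..n}. f i = c"
    and CD: "C \<union> D = {1..n} - {v}" "C \<inter> D = {}" "C \<noteq> {}" "D \<noteq> {}" and v: "v \<in> {1..n}"
    and sep: "\<And>i j. i \<in> C \<Longrightarrow> j \<in> D \<Longrightarrow> Transposition.transpose i j \<notin> T"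
    and u: "u \<in> {1..n} - {v}"
  shows "Transposition.transpose v u \<in> T"
proof (rule ccontr)
  assume nadj: "Transposition.transpose v u \<notin> T"
  have "C \<subseteq> {1..n}" "D \<subseteq> {1..n}" using CD(1) by auto
  then have fin: "finite C" "finite D" by (auto intro: finite_subset)
  have vCD: "v \<notin> C" "v \<notin> D" using CD(1) by auto
  have "T \<subseteq> {p. p permutes {1..n}}" using T transposition_permutes(1) by blast
  then have finT: "finite T" by (rule finite_subset) (simp add: finite_permutations)
  \<comment> \<open>The weights make \<open>x\<close> sum to 0 and stay nonzero off
    \<open>v\<close>. Being constant on \<open>C\<close> and on \<open>D\<close>, it varies only
    along the edges at \<open>v\<close>.\<close>
  define x where "x = (\<lambda>i. if i \<in> C then of_nat (card D) else if i \<in> D then - of_nat (card C) else 0 :: complex)"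
  define e where "e = (\<lambda>t. \<Sum>i\<in>{1..n}. (cmod (x i - x (t i)))\<^sup>2)"
  define N where "N = {w \<in> {1..n} - {v}. Transposition.transpose v w \<in> T}"
  have xv: "x v = 0" using vCD by (simp add: x_def)
  have xnz: "x i \<noteq> 0" if "i \<in> {1..n} - {v}" for i
  proof -
    have "i \<in> C \<or> i \<in> D" using that CD(1) by blast
    moreover have "card C \<noteq> 0" "card D \<noteq> 0" using CD(3,4) fin by simp_all
    ultimately show ?thesis by (auto simp: x_def)
  qed
  have supp: "x \<in> supported {1..n}"
    using \<open>C \<subseteq> _\<close> \<open>D \<subseteq> _\<close> by (auto simp: supported_def x_def)
  have "(\<Sum>i\<in>{1..n}. x i) = (\<Sum>i\<in>{1..n} - {v}. x i)"
    using v by (simp add: sum.remove[of _ v] xv)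
  also have "\<dots> = (\<Sum>i\<in>C. x i) + (\<Sum>i\<in>D. x i)"
    unfolding CD(1)[symmetric] by (rule sum.union_disjoint[OF fin CD(2)])
  also have "(\<Sum>i\<in>C. x i) = of_nat (card C) * of_nat (card D)" by (simp add: x_def)
  also have "(\<Sum>i\<in>D. x i) = (\<Sum>i\<in>D. - of_nat (card C))"
    using CD(2) by (intro sum.cong) (auto simp: x_def)
  finally have sum0: "(\<Sum>i\<in>{1..n}. x i) = 0" by simp
  \<comment> \<open>The factor 2 arises because the transposition moves both \<open>v\<close> and
    \<open>w\<close>, and \<open>x v = 0\<close>.\<close>
  have star: "e (Transposition.transpose v w) = 2 * (cmod (x w))\<^sup>2" if w: "w \<in> N" for w
  proof -
    have "e (Transposition.transpose v w) = (\<Sum>i\<in>{v, w}. (cmod (x i - x (Transposition.transpose v w i)))\<^sup>2)"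
      unfolding e_def using v w by (intro sum.mono_neutral_right) (auto simp: N_def)
    also have "\<dots> = 2 * (cmod (x w))\<^sup>2" using w by (simp add: N_def xv)
    finally show ?thesis .
  qed
  have other: "e t = 0" if t: "t \<in> T - Transposition.transpose v ` N" for t
  proof -
    obtain i j where ij: "t = Transposition.transpose i j" "i \<in> {1..n}" "j \<in> {1..n}" "i \<noteq> j"
      using t T by (blast elim: transpositionsE)
    have "i \<noteq> v"
    proof
      assume "i = v"
      then have "j \<in> N" using ij t by (simp add: N_def)
      with t ij(1) \<open>i = v\<close> show False by blast
    qed
    moreover have "j \<noteq> v"
    proof
      assume "j = v"
      then have t': "t = Transposition.transpose v i" using ij(1) by (simp add: transpose_commute)
      then have "i \<in> N" using ij t \<open>j = v\<close> by (simp add: N_def)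
      with t t' show False by blast
    qed
    ultimately have ijCD: "i \<in> C \<union> D" "j \<in> C \<union> D" unfolding CD(1) using ij by auto
    have "\<not> (i \<in> C \<and> j \<in> D)" "\<not> (j \<in> C \<and> i \<in> D)"
      using sep[of i j] sep[of j i] t ij(1) transpose_commute[of i j] by auto
    with ijCD CD(2) have "x i = x j" by (auto simp: x_def)
    then have "x (t l) = x l" for l unfolding ij(1) by (simp add: Transposition.transpose_def)
    then show ?thesis by (simp add: e_def)
  qed
  have "2 * (\<Sum>i\<in>{1..n}. (cmod (x i))\<^sup>2) \<le> (\<Sum>t\<in>T. e t)"
    unfolding e_def by (rule integral_dirichlet_ge[OF T int conn supp sum0])
  also have "\<dots> = (\<Sum>t\<in>Transposition.transpose v ` N. e t)"
    using other by (intro sum.mono_neutral_right finT) (auto simp: N_def)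
  also have "\<dots> = (\<Sum>w\<in>N. 2 * (cmod (x w))\<^sup>2)"
    using star by (simp add: sum.reindex[OF inj_on_transpose])
  also have "\<dots> = 2 * (\<Sum>w\<in>N. (cmod (x w))\<^sup>2)" by (simp add: sum_distrib_left)
  finally have "(\<Sum>i\<in>{1..n}. (cmod (x i))\<^sup>2) \<le> (\<Sum>w\<in>N. (cmod (x w))\<^sup>2)" by simp
  \<comment> \<open>The missing neighbour \<open>u\<close> contributes a positive term to the
    right-hand sum and none to the left one.\<close>
  moreover have "(\<Sum>w\<in>N. (cmod (x w))\<^sup>2) < (\<Sum>i\<in>{1..n}. (cmod (x i))\<^sup>2)"
    using u nadj xnz[OF u] by (intro sum_strict_mono2[of _ _ u]) (auto simp: N_def)
  ultimately show False by simp
qed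

section \<open>Separating vertices\<close>

lemma connected_invariant:
  assumes "graph G" "Digraph_Component.connected G"
    and "a \<in> verts G" "b \<in> verts G" "Q a"
    and step: "\<And>i j. i \<rightarrow>\<^bsub>G\<^esub> j \<Longrightarrow> Q i \<Longrightarrow> Q j"
  shows "Q b"
proof -
  interpret graph G by fact
  have "strongly_connected G"
    using sym_arcs assms(2) by (rule symmetric_connected_imp_strongly_connected)
  then have "a \<rightarrow>\<^sup>*\<^bsub>G\<^esub> b" using assms(3,4) by (simp add: strongly_connected_def)
  then show ?thesis
    by (induction rule: reachable_induct) (use step \<open>Q a\<close> in blast)+
qed

text \<open>In a symmetric graph, \<open>C\<close> and \<open>D\<close> are unions of components of
  \<open>G - v\<close>, not necessarily single ones; the test function is constant on each
  side.\<close>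

definition separates :: "('a, 'b) pre_digraph \<Rightarrow> 'a \<Rightarrow> 'a set \<Rightarrow> 'a set \<Rightarrow> bool" where
  "separates G v C D \<longleftrightarrow> C \<union> D = verts G - {v} \<and> C \<inter> D = {} \<and> C \<noteq> {} \<and> D \<noteq> {} \<and>
     (\<forall>i\<in>C. \<forall>j\<in>D. \<not> i \<rightarrow>\<^bsub>G\<^esub> j)"

lemma del_vert_dominates_iff:
  "u \<rightarrow>\<^bsub>pre_digraph.del_vert G v\<^esub> w \<longleftrightarrow> u \<rightarrow>\<^bsub>G\<^esub> w \<and> u \<noteq> v \<and> w \<noteq> v"
  by (auto simp: arcs_ends_conv pre_digraph.del_vert_def)

lemma symmetric_del_vert: "symmetric G \<Longrightarrow> symmetric (pre_digraph.del_vert G v)"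
  unfolding symmetric_def sym_def del_vert_dominates_iff by blast

text \<open>One side is the component of \<open>a\<close> in \<open>G - v\<close>. No arc leaves a
  component, and \<open>b\<close> shows that the other side is nonempty.\<close>

lemma separates_reachable:
  assumes "graph G" and v: "v \<in> verts G" "a \<in> verts G" "a \<noteq> v" "b \<in> verts G" "b \<noteq> v"
  defines "H \<equiv> pre_digraph.del_vert G v"
  assumes not: "\<not> a \<rightarrow>\<^sup>*\<^bsub>H\<^esub> b"
  shows "separates G v {w. a \<rightarrow>\<^sup>*\<^bsub>H\<^esub> w} (verts G - {v} - {w. a \<rightarrow>\<^sup>*\<^bsub>H\<^esub> w})"
proof -
  interpret graph G by fact
  interpret H: wf_digraph H unfolding H_def by (rule wf_digraph_del_vert)
  have vH: "verts H = verts G - {v}" by (simp add: H_def del_vert_simps)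
  have sub: "w \<in> verts G - {v}" if "a \<rightarrow>\<^sup>*\<^bsub>H\<^esub> w" for w
    using H.reachable_in_verts(2)[OF that] vH by simp
  have "a \<rightarrow>\<^sup>*\<^bsub>H\<^esub> a" using v vH by simp
  moreover have "\<not> i \<rightarrow>\<^bsub>G\<^esub> j" if ij: "a \<rightarrow>\<^sup>*\<^bsub>H\<^esub> i" "j \<noteq> v" "\<not> a \<rightarrow>\<^sup>*\<^bsub>H\<^esub> j" for i j
  proof
    assume "i \<rightarrow>\<^bsub>G\<^esub> j"
    then have "i \<rightarrow>\<^bsub>H\<^esub> j" using sub[OF ij(1)] ij(2) by (simp add: H_def del_vert_dominates_iff)
    with ij(1) have "a \<rightarrow>\<^sup>*\<^bsub>H\<^esub> j" by (rule H.reachable_adj_trans)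
    with ij(3) show False by contradiction
  qed
  ultimately show ?thesis
    unfolding separates_def using sub v not by blast
qed

lemma cut_vertex_separates:
  assumes "graph G" "Digraph_Component.connected G" "cut_vertex G v"
  obtains C D where "separates G v C D"
proof -
  interpret graph G by fact
  define H where "H = pre_digraph.del_vert G v"
  interpret H: wf_digraph H unfolding H_def by (rule wf_digraph_del_vert)
  have vH: "verts H = verts G - {v}" by (simp add: H_def del_vert_simps)
  have v: "v \<in> verts G" and card: "card (pre_digraph.sccs H) > card (pre_digraph.sccs G)"
    using assms(3) by (simp_all add: cut_vertex_def H_def)
  have sc: "strongly_connected G"
    using sym_arcs assms(2) by (rule symmetric_connected_imp_strongly_connected)
  \<comment> \<open>The connected graph \<open>G\<close> has at least one component, so
    \<open>H\<close> has at least two.\<close>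
  have "verts G \<in> sccs_verts"
    using sc unfolding sccs_verts_def strongly_connected_def by (auto dest: reachable_in_verts)
  moreover have "sccs_verts \<subseteq> Pow (verts G)"
    unfolding sccs_verts_def by (auto dest: reachable_in_verts)
  ultimately have "card sccs_verts \<noteq> 0"
    by (metis card_eq_0_iff empty_iff finite_Pow_iff finite_subset finite_verts)
  then have "\<not> card H.sccs_verts \<le> Suc 0"
    using card by (simp add: card_sccs_verts H.card_sccs_verts)
  then obtain S S' where S: "S \<in> H.sccs_verts" "S' \<in> H.sccs_verts" "S \<noteq> S'"
    by (metis card.infinite card_le_Suc0_iff_eq le0)
  then have disj: "S \<inter> S' = {}" by (rule H.sccs_verts_disjoint)
  obtain a b where ab: "a \<in> S" "b \<in> S'" using S unfolding H.sccs_verts_def by blast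
  have sym: "symmetric H" unfolding H_def by (rule symmetric_del_vert[OF sym_arcs])
  have "b \<notin> S" using disj ab by blast
  \<comment> \<open>Reachability in \<open>H\<close> is symmetric, so reaching \<open>b\<close> from
    \<open>a\<close> would put both into the same component.\<close>
  then have "\<not> a \<rightarrow>\<^sup>*\<^bsub>H\<^esub> b"
    using S(1) ab(1) symmetric_reachable[OF sym] unfolding H.sccs_verts_def by blast
  moreover have "a \<in> verts H" "b \<in> verts H"
    using S ab unfolding H.sccs_verts_def by (blast dest: H.reachable_in_verts)+
  ultimately show thesis
    using that separates_reachable[OF assms(1) v, of a b] vH unfolding H_def by blast
qed

text \<open>A path from \<open>a\<close> to \<open>b\<close> avoiding \<open>v\<close> would close
  up through \<open>v\<close> to a cycle.\<close>

lemma acyclic_separates: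
  assumes "graph G" and acyc: "\<not> (\<exists>p. pre_digraph.cycle G p \<and> length p \<ge> 3)"
    and ab: "v \<rightarrow>\<^bsub>G\<^esub> a" "v \<rightarrow>\<^bsub>G\<^esub> b" "a \<noteq> b"
  obtains C D where "separates G v C D"
proof -
  interpret graph G by fact
  define H where "H = pre_digraph.del_vert G v"
  interpret H: wf_digraph H unfolding H_def by (rule wf_digraph_del_vert)
  have vH: "verts H = verts G - {v}" by (simp add: H_def del_vert_simps)
  have verts: "v \<in> verts G" "a \<in> verts G" "b \<in> verts G" "a \<noteq> v" "b \<noteq> v"
    using ab adj_in_verts adj_not_same by blast+
  have "\<not> a \<rightarrow>\<^sup>*\<^bsub>H\<^esub> b"
  proof
    assume "a \<rightarrow>\<^sup>*\<^bsub>H\<^esub> b"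
    then obtain q where "H.awalk a q b" unfolding H.reachable_awalk by blast
    then have "H.apath a (H.awalk_to_apath q) b" by (rule H.apath_awalk_to_apath)
    then obtain p where p: "H.awalk a p b" "distinct (H.awalk_verts a p)"
      unfolding H.apath_def by blast
    have "subgraph H G" unfolding H_def by (rule subgraph_del_vert)
    with p(1) have pG: "awalk a p b" by (rule subgraph_awalk_imp_awalk)
    have "v \<notin> set (H.awalk_verts a p)"
      using p(1) vH unfolding H.awalk_conv by blast
    moreover have eq: "H.awalk_verts a p = awalk_verts a p"
      unfolding H.awalk_verts_conv awalk_verts_conv by (simp add: H_def del_vert_simps)
    ultimately have dist: "distinct (awalk_verts a p @ [v])" using p(2) by simp
    \<comment> \<open>As \<open>a\<close> and \<open>b\<close> differ, the path has an arc; with the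
      two arcs at \<open>v\<close> the cycle has length at least 3, so it is not a walk back and
      forth along one edge.\<close>
    have "p \<noteq> []" using pG ab(3) by (auto simp: awalk_Nil_iff)
    obtain e where e: "e \<in> arcs G" "tail G e = v" "head G e = a" using ab(1) by (rule reachableE)
    have "b \<rightarrow>\<^bsub>G\<^esub> v" using ab(2) sym_arcs by (simp add: arcs_ends_symmetric)
    then obtain e' where e': "e' \<in> arcs G" "tail G e' = b" "head G e' = v" by (rule reachableE)
    have w: "awalk v (e # p @ [e']) v"
    proof -
      have "awalk b [e'] v" using e' verts by (simp add: awalk_simps)
      with pG have "awalk a (p @ [e']) v" by (rule awalk_appendI)
      then show ?thesis unfolding awalk_Cons_iff by (simp only: e simp_thms)
    qed
    have "awlast a p = b" using pG by (blast elim: awalkE)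
    have "awalk_verts a (p @ [e']) = awalk_verts a p @ [v]"
      using \<open>p \<noteq> []\<close> \<open>awlast a p = b\<close> e' by (simp add: awalk_verts_conv)
    then have "distinct (tl (awalk_verts v (e # p @ [e'])))" using dist e by simp
    with w have "cycle (e # p @ [e'])" unfolding cycle_def by blast
    moreover have "length (e # p @ [e']) \<ge> 3" using \<open>p \<noteq> []\<close> by (cases p) auto
    ultimately show False using acyc by blast
  qed
  then show thesis
    using that separates_reachable[OF assms(1) verts(1,2,4,3,5)] unfolding H_def by blast
qed

lemma acyclic_no_triangle:
  assumes "graph G" and acyc: "\<not> (\<exists>p. pre_digraph.cycle G p \<and> length p \<ge> 3)"
    and edges: "v \<rightarrow>\<^bsub>G\<^esub> a" "a \<rightarrow>\<^bsub>G\<^esub> b" "b \<rightarrow>\<^bsub>G\<^esub> v"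
  shows False
proof -
  interpret graph G by fact
  obtain e1 where e1: "e1 \<in> arcs G" "tail G e1 = v" "head G e1 = a" using edges(1) by (rule reachableE)
  obtain e2 where e2: "e2 \<in> arcs G" "tail G e2 = a" "head G e2 = b" using edges(2) by (rule reachableE)
  obtain e3 where e3: "e3 \<in> arcs G" "tail G e3 = b" "head G e3 = v" using edges(3) by (rule reachableE)
  have "v \<noteq> a" "a \<noteq> b" "b \<noteq> v" using edges adj_not_same by blast+
  moreover have "awalk v [e1, e2, e3] v"
    using e1 e2 e3 adj_in_verts(1)[OF edges(1)] by (simp add: awalk_simps)
  ultimately have "cycle [e1, e2, e3]"
    unfolding cycle_def using e1 e2 e3 by (intro exI[of _ v]) auto
  with acyc show False by fastforce
qed

section \<open>Integrality for transposition graphs, trees and stars\<close>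

lemma transposition_graph_dominates_iff:
  "i \<rightarrow>\<^bsub>transposition_graph n T\<^esub> j \<longleftrightarrow>
     i \<in> {1..n} \<and> j \<in> {1..n} \<and> i \<noteq> j \<and> Transposition.transpose i j \<in> T"
  by (auto simp: transposition_graph_def arcs_ends_conv)

lemma verts_transposition_graph: "verts (transposition_graph n T) = {1..n}"
  by (simp add: transposition_graph_def)

lemma integral_separates_complete:
  assumes T: "T \<subseteq> transpositions n"
  defines "G \<equiv> transposition_graph n T"
  assumes conn: "Digraph_Component.connected G" and v: "v \<in> verts G" and sep: "separates G v C D"
    and int: "integral_graph (cayley_graph (sym_group n) T)"
  shows "complete_vertex G v"
proof -
  have graph: "graph G" unfolding G_def by (rule graph_transposition_graph)
  have V: "verts G = {1..n}" unfolding G_def by (rule verts_transposition_graph)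
  have intM: "integral_operator (supported {1..n}) (action_sum (\<lambda>t. t) T)"
    using int T by (simp only: integral_cayley_graph_iff integral_operator_natural)
  \<comment> \<open>Invariance under \<open>T\<close> propagates the value at \<open>v\<close> along
    the edges to the whole connected graph.\<close>
  have const: "\<exists>c. \<forall>i\<in>{1..n}. f i = c"
    if f: "\<And>t i. t \<in> T \<Longrightarrow> i \<in> {1..n} \<Longrightarrow> f (t i) = f i" for f :: "nat \<Rightarrow> complex"
  proof (intro exI ballI)
    fix i assume i: "i \<in> {1..n}"
    show "f i = f v"
    proof (rule connected_invariant[OF graph conn v, where Q = "\<lambda>i. f i = f v"])
      fix i j assume ij: "i \<rightarrow>\<^bsub>G\<^esub> j" "f i = f v"
      then have "Transposition.transpose i j \<in> T" "i \<in> {1..n}"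
        by (simp_all add: G_def transposition_graph_dominates_iff)
      from f[OF this] ij(2) show "f j = f v" by simp
    qed (use V i in blast)+
  qed
  have "Transposition.transpose v u \<in> T" if u: "u \<in> {1..n} - {v}" for u
  proof (rule separating_vertex_complete[OF T intM const, where C = C and D = D])
    fix i j assume ij: "i \<in> C" "j \<in> D"
    have "i \<noteq> j" "i \<in> {1..n}" "j \<in> {1..n}" using ij sep unfolding separates_def V by blast+
    moreover have "\<not> i \<rightarrow>\<^bsub>G\<^esub> j" using ij sep unfolding separates_def by blast
    ultimately show "Transposition.transpose i j \<notin> T"
      unfolding G_def transposition_graph_dominates_iff by blast
  qed (use sep v u in \<open>unfold separates_def V, blast\<close>)+
  then show ?thesis
    unfolding complete_vertex_def using v
    by (simp add: G_def transposition_graph_dominates_iff verts_transposition_graph)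
qed

lemma integral_complete_vertex_iff:
  assumes T: "T \<subseteq> transpositions n" and v: "complete_vertex (transposition_graph n T) v"
  shows "integral_graph (cayley_graph (sym_group n) T) \<longleftrightarrow>
    integral_graph (cayley_graph (sym_group n) {t \<in> T. t v = v})"
proof -
  have "v \<in> {1..n}" "Transposition.transpose v ` ({1..n} - {v}) \<subseteq> T"
    using v unfolding complete_vertex_def transposition_graph_dominates_iff verts_transposition_graph
    by blast+
  moreover have "{t \<in> T. t v = v} \<subseteq> transpositions n" using T by blast
  ultimately show ?thesis
    using integral_operator_complete_vertex_iff[OF T] by (simp only: integral_cayley_graph_iff T)
qed

text \<open>A set of transpositions can be read off from the arcs of its graph, and a transposition
  fixes \<open>v\<close> exactly when \<open>v\<close> is not one of its two points.\<close>

lemma transpositions_isolate_vertex: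
  assumes T: "T \<subseteq> transpositions n" and T': "T' \<subseteq> transpositions n"
    and eq: "transposition_graph n T' =
      pre_digraph.add_vert (pre_digraph.del_vert (transposition_graph n T) v) v"
  shows "T' = {t \<in> T. t v = v}"
proof -
  have arcs: "arcs (transposition_graph n T') =
      {a \<in> arcs (transposition_graph n T). fst a \<noteq> v \<and> snd a \<noteq> v}"
    unfolding eq pre_digraph.add_vert_def pre_digraph.del_vert_def by (simp add: transposition_graph_def)
  have *: "Transposition.transpose i j \<in> T' \<longleftrightarrow> Transposition.transpose i j \<in> T \<and> i \<noteq> v \<and> j \<noteq> v"
    if ij: "i \<in> {1..n}" "j \<in> {1..n}" "i \<noteq> j" for i j
  proof -
    have "(i, j) \<in> arcs (transposition_graph n S) \<longleftrightarrow> Transposition.transpose i j \<in> S" for S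
      using ij by (simp add: transposition_graph_def)
    from this[of T'] this[of T] show ?thesis unfolding arcs by simp
  qed
  have fixes_iff: "Transposition.transpose i j v = v \<longleftrightarrow> i \<noteq> v \<and> j \<noteq> v" if "i \<noteq> j" for i j
    using that by (auto simp: Transposition.transpose_def)
  show ?thesis
  proof (intro equalityI subsetI)
    fix t assume t: "t \<in> T'"
    then obtain i j where ij: "t = Transposition.transpose i j" "i \<in> {1..n}" "j \<in> {1..n}" "i \<noteq> j"
      using T' by (blast elim: transpositionsE)
    then show "t \<in> {t \<in> T. t v = v}" using t *[OF ij(2-4)] fixes_iff[OF ij(4)] by simp
  next
    fix t assume t: "t \<in> {t \<in> T. t v = v}"
    then obtain i j where ij: "t = Transposition.transpose i j" "i \<in> {1..n}" "j \<in> {1..n}" "i \<noteq> j"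
      using T by (blast elim: transpositionsE)
    then show "t \<in> T'" using t *[OF ij(2-4)] fixes_iff[OF ij(4)] by simp
  qed
qed

text \<open>A vertex with two neighbours separates because there are no cycles. Otherwise every
  vertex has at most one neighbour, and a connected graph of that kind is a single vertex or a
  single edge, where every vertex is complete.\<close>

lemma tree_complete_vertex_or_separates:
  assumes "graph G" "Digraph_Component.connected G"
    and acyc: "\<not> (\<exists>p. pre_digraph.cycle G p \<and> length p \<ge> 3)"
  obtains v where "complete_vertex G v"
    | v C D where "v \<in> verts G" "separates G v C D"
proof (cases "\<exists>v a b. v \<rightarrow>\<^bsub>G\<^esub> a \<and> v \<rightarrow>\<^bsub>G\<^esub> b \<and> a \<noteq> b")
  case True
  then obtain v a b where "v \<rightarrow>\<^bsub>G\<^esub> a" "v \<rightarrow>\<^bsub>G\<^esub> b" "a \<noteq> b" by blast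
  interpret graph G by fact
  from \<open>v \<rightarrow>\<^bsub>G\<^esub> a\<close> have "v \<in> verts G" by (rule adj_in_verts)
  then show thesis
    using acyclic_separates[OF assms(1) acyc \<open>v \<rightarrow>\<^bsub>G\<^esub> a\<close> \<open>v \<rightarrow>\<^bsub>G\<^esub> b\<close> \<open>a \<noteq> b\<close>] that(2) by blast
next
  case False
  then have unique: "a = b" if "v \<rightarrow>\<^bsub>G\<^esub> a" "v \<rightarrow>\<^bsub>G\<^esub> b" for v a b using that by blast
  interpret graph G by fact
  have sym: "j \<rightarrow>\<^bsub>G\<^esub> i" if "i \<rightarrow>\<^bsub>G\<^esub> j" for i j using that sym_arcs by (simp add: arcs_ends_symmetric)
  have "verts G \<noteq> {}" using assms(2) unfolding connected_conv by blast
  then obtain v where v: "v \<in> verts G" by blast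
  have "v \<rightarrow>\<^bsub>G\<^esub> u" if u: "u \<in> verts G" "u \<noteq> v" for u
  proof -
    have "u = v \<or> v \<rightarrow>\<^bsub>G\<^esub> u"
      by (rule connected_invariant[OF assms(1,2) v u(1), where Q = "\<lambda>u. u = v \<or> v \<rightarrow>\<^bsub>G\<^esub> u"])
        (use unique sym in blast)+
    with u(2) show ?thesis by simp
  qed
  with v have "complete_vertex G v" by (simp add: complete_vertex_def)
  then show thesis by (rule that(1))
qed

text \<open>An edge avoiding the complete vertex \<open>v\<close> would form a triangle with
  it.\<close>

lemma acyclic_complete_vertex_star:
  assumes "graph G" and acyc: "\<not> (\<exists>p. pre_digraph.cycle G p \<and> length p \<ge> 3)"
    and v: "complete_vertex G v"
  shows "complete_bipartite_digraph 1 (card (verts G) - 1) G"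
proof -
  interpret graph G by fact
  have sym: "j \<rightarrow>\<^bsub>G\<^esub> i" if "i \<rightarrow>\<^bsub>G\<^esub> j" for i j using that sym_arcs by (simp add: arcs_ends_symmetric)
  have adj: "v \<rightarrow>\<^bsub>G\<^esub> u" if "u \<in> verts G" "u \<noteq> v" for u
    using v that unfolding complete_vertex_def by blast+
  have vG: "v \<in> verts G" using v unfolding complete_vertex_def by blast
  have "arcs_ends G = {v} \<times> (verts G - {v}) \<union> (verts G - {v}) \<times> {v}" (is "_ = ?R")
  proof (intro equalityI subsetI)
    fix e assume e: "e \<in> arcs_ends G"
    obtain i j where ij: "e = (i, j)" by fastforce
    have "i \<rightarrow>\<^bsub>G\<^esub> j" using e ij by simp
    then have "i \<in> verts G" "j \<in> verts G" "i \<noteq> j" using adj_in_verts adj_not_same by blast+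
    moreover have "i = v \<or> j = v"
      using acyclic_no_triangle[OF assms(1) acyc adj \<open>i \<rightarrow>\<^bsub>G\<^esub> j\<close> sym[OF adj]] \<open>i \<in> _\<close> \<open>j \<in> _\<close>
      by blast
    ultimately show "e \<in> ?R" unfolding ij by blast
  next
    fix e assume "e \<in> ?R"
    then show "e \<in> arcs_ends G" using adj sym by blast
  qed
  moreover have "verts G = {v} \<union> (verts G - {v})" "{v} \<inter> (verts G - {v}) = {}" using vG by blast+
  moreover have "card {v} = 1" "card (verts G - {v}) = card (verts G) - 1" using vG by simp_all
  ultimately show ?thesis unfolding complete_bipartite_digraph_def using assms(1) by metis
qed

text \<open>Every edge of a star contains the centre \<open>v\<close>, so no transposition in
  \<open>T\<close> fixes \<open>v\<close>; removing the edges at \<open>v\<close> leaves the zero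
  operator, whose only eigenvalue is 0.\<close>

lemma integral_star:
  assumes T: "T \<subseteq> transpositions n"
    and star: "complete_bipartite_digraph 1 m (transposition_graph n T)"
  shows "integral_graph (cayley_graph (sym_group n) T)"
proof -
  let ?G = "transposition_graph n T"
  obtain U V where UV: "verts ?G = U \<union> V" "U \<inter> V = {}" "card U = 1"
    "arcs_ends ?G = U \<times> V \<union> V \<times> U"
    using star unfolding complete_bipartite_digraph_def by blast
  then obtain v where U: "U = {v}" by (auto simp: card_1_singleton_iff)
  have v: "complete_vertex ?G v"
    unfolding complete_vertex_def using UV U by blast
  have "t v \<noteq> v" if t: "t \<in> T" for t
  proof -
    obtain i j where ij: "t = Transposition.transpose i j" "i \<in> {1..n}" "j \<in> {1..n}" "i \<noteq> j"
      using t T by (blast elim: transpositionsE)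
    then have "i \<rightarrow>\<^bsub>?G\<^esub> j" using t by (simp add: transposition_graph_dominates_iff)
    then have "i = v \<or> j = v" unfolding UV(4) U by blast
    then show ?thesis using ij(1,4) by (auto simp: Transposition.transpose_def)
  qed
  then have "{t \<in> T. t v = v} = {}" by blast
  moreover have "integral_operator W (action_sum (\<circ>) {})" for W :: "((nat \<Rightarrow> nat) \<Rightarrow> complex) set"
    unfolding integral_operator_def by (auto simp: action_sum_def fun_eq_iff)
  ultimately show ?thesis
    unfolding integral_complete_vertex_iff[OF T v] by (simp only: integral_cayley_graph_iff empty_subsetI)
qed

theorem corollary1:
  fixes n :: nat and T :: "(nat \<Rightarrow> nat) set"
  assumes "T \<subseteq> transpositions n"
  shows "(\<forall>v T'. Digraph_Component.connected (transposition_graph n T) \<and>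
            cut_vertex (transposition_graph n T) v \<and>
            T' \<subseteq> transpositions n \<and>
            transposition_graph n T' =
              pre_digraph.add_vert (pre_digraph.del_vert (transposition_graph n T) v) v \<longrightarrow>
            (integral_graph (cayley_graph (sym_group n) T) \<longleftrightarrow>
              complete_vertex (transposition_graph n T) v \<and>
              integral_graph (cayley_graph (sym_group n) T'))) \<and>
         (tree_graph (transposition_graph n T) \<longrightarrow>
            (integral_graph (cayley_graph (sym_group n) T) \<longleftrightarrow>
              complete_bipartite_digraph 1 (n - 1) (transposition_graph n T)))"
proof (intro conjI allI impI; (elim conjE)?)
  let ?G = "transposition_graph n T"
  fix v T'
  assume conn: "Digraph_Component.connected ?G" and cut: "cut_vertex ?G v"
    and T': "T' \<subseteq> transpositions n"
      "transposition_graph n T' = pre_digraph.add_vert (pre_digraph.del_vert ?G v) v"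
  obtain C D where sep: "separates ?G v C D"
    using graph_transposition_graph conn cut by (rule cut_vertex_separates)
  have "v \<in> verts ?G" using cut by (simp add: cut_vertex_def)
  then have "complete_vertex ?G v" if "integral_graph (cayley_graph (sym_group n) T)"
    using integral_separates_complete[OF assms conn _ sep that] by blast
  moreover have "T' = {t \<in> T. t v = v}" by (rule transpositions_isolate_vertex[OF assms T'])
  ultimately show "integral_graph (cayley_graph (sym_group n) T) \<longleftrightarrow>
      complete_vertex ?G v \<and> integral_graph (cayley_graph (sym_group n) T')"
    using integral_complete_vertex_iff[OF assms] by blast
next
  let ?G = "transposition_graph n T"
  assume "tree_graph ?G"
  then have graph: "graph ?G" and conn: "Digraph_Component.connected ?G"
    and acyc: "\<not> (\<exists>p. pre_digraph.cycle ?G p \<and> length p \<ge> 3)"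
    unfolding tree_graph_def by blast+
  show "integral_graph (cayley_graph (sym_group n) T) \<longleftrightarrow> complete_bipartite_digraph 1 (n - 1) ?G"
  proof
    assume int: "integral_graph (cayley_graph (sym_group n) T)"
    \<comment> \<open>A separating vertex is complete by integrality, so both alternatives end in a
      complete vertex.\<close>
    obtain v where "complete_vertex ?G v"
      using tree_complete_vertex_or_separates[OF graph conn acyc]
        integral_separates_complete[OF assms conn _ _ int] by blast
    from acyclic_complete_vertex_star[OF graph acyc this]
    show "complete_bipartite_digraph 1 (n - 1) ?G" by (simp add: verts_transposition_graph)
  qed (rule integral_star[OF assms])
qed

end
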